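(* Let $A$ and $B$ be formulas of multiplicative-additive linear logic (MALL). If $A$ and $B$ are isomorphic types, i.e. there are proofs $\pi$ of $A\vdash B$ and $\pi^{-1}$ of $B\vdash A$ such that $\mathit{cut}(\pi,\pi^{-1})$ reduces by cut-elimination to the axiom $\mathit{ax}_A$ and $\mathit{cut}(\pi^{-1},\pi)$ reduces by cut-elimination to the axiom $\mathit{ax}_B$, then for every $k\in\mathbb{N}$ there is an isomorphism of $\mathbb{Z}$-modules $\mathcal{H}_k(\mathscr{I}[A])\cong\mathcal{H}_k(\mathscr{I}[B])$.
   Context: Abstract simplicial complexes and homology. An abstract simplicial complex (asc) $X$ consists of an at most countable set $|X|$ (the web) and a set $\mathcal{S}X$ (the simplices) of finite nonempty subsets of $|X|$ which is downward closed (every nonempty subset of an element of $\mathcal{S}X$ is in $\mathcal{S}X$) and contains all singletons of elements of $|X|$. $\mathcal{H}_k(X)$ denotes the $k$-th simplicial homology $\mathbb{Z}$-module of $X$, i.e. $\mathrm{Ker}(\partial_k)/\mathrm{Im}(\partial_{k+1})$ for the usual chain complex of oriented simplices of $X$ with coefficients in $\mathbb{Z}$ (with $\partial_0=0$). The complex $\mathscr{I}X$. $\mathscr{I}X$ is the asc with web $\mathcal{S}X$ whose simplices are the finite nonempty sets $\{u_0,\dots,u_n\}\subseteq\mathcal{S}X$ with $\bigcup_{i=0}^n u_i\in\mathcal{S}X$ (it depends only on $\mathcal{S}X$). Relational semantics of MALL. Formulas are built from literals $\alpha,\alpha^\perp$ and the units $1,\bot,0,\top$ with $\otimes,\mathbin{\mathrm{par}},\oplus,\&$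 (where $\mathrm{par}$ is the multiplicative disjunction of linear logic, usually written as an inverted ampersand); linear negation $(\cdot)^\perp$ is defined by De Morgan duality, and $A\vdash B$ denotes the one-sided sequent $\vdash A^\perp,B$ of the standard MALL sequent calculus (rules: axiom, cut, exchange, $1$, $\bot$, $\otimes$, $\mathrm{par}$, $\oplus_1$, $\oplus_2$, $\&$, $\top$; no rule for $0$). Here $\mathit{cut}(\pi,\pi^{-1})$ is the proof of $A\vdash A$ obtained by a cut on $B$, $\mathit{cut}(\pi^{-1},\pi)$ is the proof of $B\vdash B$ obtained by a cut on $A$, and $\mathit{ax}_A$ is the axiom $A\vdash A$. Each formula $A$ is interpreted by a set, denoted $|A|$: a fixed at most countable set for each atom $\alpha$, with $|\alpha^\perp|=|\alpha|$; $|1|=|\bot|=\{*\}$; $|0|=|\top|=\emptyset$; $|A\otimes B|=|A\mathbin{\mathrm{par}} B|=|A|\times|B|$; $|A\oplus B|=|A\,\&\,B|=|A|\sqcup|B|$ (disjoint union, with elements written $(1,a)$, $(2,b)$). A proof $\pi$ of $\vdash A_1,\dots,A_n$ is interpreted by a relation $\llbracket\pi\rrbracket\subseteq|A_1|\times\cdots\times|A_n|$, defined by induction on $\pi$ (writing $\gamma,\delta$ for tuples of points of the contexts): - axiom: $\{(a,a)\mid a\in|A|\}$; - cut of $\pi_1$ and $\pi_2$: $\{(\gamma,\delta)\mid\exists a,\ (\gamma,a)\in\llbracket\pi_1\rrbracket,\ (a,\delta)\in\llbracket\pi_2\rrbracket\}$; - exchange: permutation of components; - $1$: $\{*\}$;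 - $\bot$: $\{(\gamma,* )\mid\gamma\in\llbracket\pi_1\rrbracket\}$; - $\otimes$: $\{(\gamma,\delta,(a,b))\mid(\gamma,a)\in\llbracket\pi_1\rrbracket,\ (\delta,b)\in\llbracket\pi_2\rrbracket\}$; - $\mathrm{par}$: $\{(\gamma,(a,b))\mid(\gamma,a,b)\in\llbracket\pi_1\rrbracket\}$; - $\oplus_i$: $\{(\gamma,(i,a))\mid(\gamma,a)\in\llbracket\pi_1\rrbracket\}$; - $\&$: $\{(\gamma,(1,a))\mid(\gamma,a)\in\llbracket\pi_1\rrbracket\}\cup\{(\gamma,(2,b))\mid(\gamma,b)\in\llbracket\pi_2\rrbracket\}$; - $\top$: $\emptyset$. The complex $[A]$. For a formula $A$, $[A]$ has web $|A|$ and set of simplices $\mathcal{S}[A]:=\{x \mid x \text{ finite nonempty},\ x\subseteq\llbracket\pi\rrbracket \text{ for some proof } \pi \text{ of } \vdash A\}$. Thus $\mathscr{I}[A]$ is the asc with web $\mathcal{S}[A]$ whose simplices are the finite nonempty sets $\{u_0,\dots,u_n\}\subseteq\mathcal{S}[A]$ with $\bigcup_i u_i\in\mathcal{S}[A]$. *)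

theory Defs
  imports "HOL-Algebra.Free_Abelian_Groups" "HOL-Combinatorics.Permutations"
begin

section \<open>Formulas and proofs of MALL\<close>

datatype 'a formula =
    Pos 'a | Neg 'a
  | One | Bot | Zero | Top
  | Tensor "'a formula" "'a formula"
  | Par "'a formula" "'a formula"
  | Plus "'a formula" "'a formula"
  | With "'a formula" "'a formula"

fun dual :: "'a formula \<Rightarrow> 'a formula" where
  "dual (Pos a) = Neg a"
| "dual (Neg a) = Pos a"
| "dual One = Bot"
| "dual Bot = One"
| "dual Zero = Top"
| "dual Top = Zero"
| "dual (Tensor A B) = Par (dual A) (dual B)"
| "dual (Par A B) = Tensor (dual A) (dual B)"
| "dual (Plus A B) = With (dual A) (dual B)"
| "dual (With A B) = Plus (dual A) (dual B)"

lemma dual_dual [simp]: "dual (dual A) = A"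
  by (induction A) auto

text \<open>
  A sequent is a list of formulas. Derivations carry just enough annotations for
  \<open>proves\<close> below to determine the conclusion. The argument of \<open>PlusR1\<close> (\<open>PlusR2\<close>) is the
  right (left) summand, that of \<open>Ax\<close> the formula \<open>A\<close> of \<open>\<turnstile> A\<^sup>\<bottom>, A\<close>, that of \<open>Cut\<close> the formula
  as it occurs in the left premise, that of \<open>TopR\<close> the context.
\<close>

datatype 'a derivation =
    Ax "'a formula"
  | Cut "'a formula" "'a derivation" "'a derivation"
  | Exch "nat \<Rightarrow> nat" "'a derivation"
  | OneR
  | BotR "'a derivation"
  | TensorR "'a derivation" "'a derivation"
  | ParR "'a derivation"
  | PlusR1 "'a formula" "'a derivation"
  | PlusR2 "'a formula" "'a derivation"
  | WithR "'a derivation" "'a derivation"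
  | TopR "'a formula list"

inductive proves :: "'a derivation \<Rightarrow> 'a formula list \<Rightarrow> bool" where
  ax: "proves (Ax A) [dual A, A]"
| cut: "proves \<pi> (\<Gamma> @ [A]) \<Longrightarrow> proves \<rho> (dual A # \<Delta>) \<Longrightarrow> proves (Cut A \<pi> \<rho>) (\<Gamma> @ \<Delta>)"
| exch: "proves \<pi> \<Gamma> \<Longrightarrow> p permutes {..<length \<Gamma>} \<Longrightarrow> proves (Exch p \<pi>) (permute_list p \<Gamma>)"
| one: "proves OneR [One]"
| bot: "proves \<pi> \<Gamma> \<Longrightarrow> proves (BotR \<pi>) (\<Gamma> @ [Bot])"
| tensor: "proves \<pi> (\<Gamma> @ [A]) \<Longrightarrow> proves \<rho> (\<Delta> @ [B]) \<Longrightarrow>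
    proves (TensorR \<pi> \<rho>) (\<Gamma> @ \<Delta> @ [Tensor A B])"
| par: "proves \<pi> (\<Gamma> @ [A, B]) \<Longrightarrow> proves (ParR \<pi>) (\<Gamma> @ [Par A B])"
| plus1: "proves \<pi> (\<Gamma> @ [A]) \<Longrightarrow> proves (PlusR1 B \<pi>) (\<Gamma> @ [Plus A B])"
| plus2: "proves \<pi> (\<Gamma> @ [B]) \<Longrightarrow> proves (PlusR2 A \<pi>) (\<Gamma> @ [Plus A B])"
| with_rule: "proves \<pi> (\<Gamma> @ [A]) \<Longrightarrow> proves \<rho> (\<Gamma> @ [B]) \<Longrightarrow> proves (WithR \<pi> \<rho>) (\<Gamma> @ [With A B])"
| top: "proves (TopR \<Gamma>) (\<Gamma> @ [Top])"


section \<open>Cut elimination\<close>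

text \<open>
  \<open>swap_blocks n m\<close> is the permutation for which \<open>permute_list (swap_blocks n m) (xs @ ys) = ys @ xs\<close>
  when \<open>length xs = n\<close> and \<open>length ys = m\<close>; \<open>juxt n p q\<close> acts as \<open>p\<close> on the first \<open>n\<close> positions and
  as \<open>q\<close> on the following ones.
\<close>

definition swap_blocks :: "nat \<Rightarrow> nat \<Rightarrow> nat \<Rightarrow> nat" where
  "swap_blocks n m i = (if i < m then n + i else if i < n + m then i - m else i)"

definition juxt :: "nat \<Rightarrow> (nat \<Rightarrow> nat) \<Rightarrow> (nat \<Rightarrow> nat) \<Rightarrow> nat \<Rightarrow> nat" where
  "juxt n p q i = (if i < n then p i else n + q (i - n))"

text \<open>
  Bookkeeping for the exchange rule: exchanges compose, every rule commutes with the exchanges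
  of its contexts, and axioms and cuts are symmetric in \<open>A\<close> and \<open>A\<^sup>\<bottom>\<close>.
\<close>

inductive exch_rule :: "'a derivation \<Rightarrow> 'a derivation \<Rightarrow> bool" where
  exch_id: "proves \<pi> \<Gamma> \<Longrightarrow> exch_rule (Exch id \<pi>) \<pi>"
| exch_comp: "proves \<pi> \<Gamma> \<Longrightarrow> p permutes {..<length \<Gamma>} \<Longrightarrow> q permutes {..<length \<Gamma>} \<Longrightarrow>
    exch_rule (Exch p (Exch q \<pi>)) (Exch (q \<circ> p) \<pi>)"
| exch_ax: "exch_rule (Exch (swap_blocks 1 1) (Ax A)) (Ax (dual A))"
| exch_cut_sym: "proves \<pi> (\<Gamma> @ [A]) \<Longrightarrow> proves \<rho> (dual A # \<Delta>) \<Longrightarrow>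
    exch_rule (Exch (swap_blocks (length \<Gamma>) (length \<Delta>)) (Cut A \<pi> \<rho>))
      (Cut (dual A) (Exch (swap_blocks 1 (length \<Delta>)) \<rho>) (Exch (swap_blocks (length \<Gamma>) 1) \<pi>))"
| exch_cut: "proves \<pi> (\<Gamma> @ [A]) \<Longrightarrow> proves \<rho> (dual A # \<Delta>) \<Longrightarrow>
    p permutes {..<length \<Gamma>} \<Longrightarrow> q permutes {..<length \<Delta>} \<Longrightarrow>
    exch_rule (Exch (juxt (length \<Gamma>) p q) (Cut A \<pi> \<rho>)) (Cut A (Exch p \<pi>) (Exch (juxt 1 id q) \<rho>))"
| exch_bot: "proves \<pi> \<Gamma> \<Longrightarrow> p permutes {..<length \<Gamma>} \<Longrightarrow>
    exch_rule (Exch p (BotR \<pi>)) (BotR (Exch p \<pi>))"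
| exch_tensor: "proves \<pi> (\<Gamma> @ [A]) \<Longrightarrow> proves \<rho> (\<Delta> @ [B]) \<Longrightarrow>
    p permutes {..<length \<Gamma>} \<Longrightarrow> q permutes {..<length \<Delta>} \<Longrightarrow>
    exch_rule (Exch (juxt (length \<Gamma>) p q) (TensorR \<pi> \<rho>)) (TensorR (Exch p \<pi>) (Exch q \<rho>))"
| exch_par: "proves \<pi> (\<Gamma> @ [A, B]) \<Longrightarrow> p permutes {..<length \<Gamma>} \<Longrightarrow>
    exch_rule (Exch p (ParR \<pi>)) (ParR (Exch p \<pi>))"
| exch_plus1: "proves \<pi> (\<Gamma> @ [A]) \<Longrightarrow> p permutes {..<length \<Gamma>} \<Longrightarrow>
    exch_rule (Exch p (PlusR1 B \<pi>)) (PlusR1 B (Exch p \<pi>))"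
| exch_plus2: "proves \<pi> (\<Gamma> @ [B]) \<Longrightarrow> p permutes {..<length \<Gamma>} \<Longrightarrow>
    exch_rule (Exch p (PlusR2 A \<pi>)) (PlusR2 A (Exch p \<pi>))"
| exch_with: "proves \<pi> (\<Gamma> @ [A]) \<Longrightarrow> proves \<rho> (\<Gamma> @ [B]) \<Longrightarrow> p permutes {..<length \<Gamma>} \<Longrightarrow>
    exch_rule (Exch p (WithR \<pi> \<rho>)) (WithR (Exch p \<pi>) (Exch p \<rho>))"
| exch_top: "p permutes {..<length \<Gamma>} \<Longrightarrow>
    exch_rule (Exch p (TopR \<Gamma>)) (TopR (permute_list p \<Gamma>))"

text \<open>
  The cut-elimination rules. The principal formula of a logical rule is the last one of its
  conclusion, whereas the cut formula is the first one of the right premise; the exchanges on the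
  left-hand sides make up for this. The commutative rules only treat a cut formula that is not
  principal in the right premise, and the key rules only one choice of sides; the
  other cases are obtained with \<open>exch_cut_sym\<close>.
\<close>

inductive cut_rule :: "'a derivation \<Rightarrow> 'a derivation \<Rightarrow> bool" where
  cut_ax_right: "proves \<pi> (\<Gamma> @ [A]) \<Longrightarrow> cut_rule (Cut A \<pi> (Ax A)) \<pi>"
| cut_ax_left: "proves \<rho> (dual A # \<Delta>) \<Longrightarrow> cut_rule (Cut A (Ax A) \<rho>) \<rho>"
| cut_one_bot: "proves \<rho> \<Delta> \<Longrightarrow>
    cut_rule (Cut One OneR (Exch (swap_blocks (length \<Delta>) 1) (BotR \<rho>))) \<rho>"
| cut_tensor_par:
    "proves \<pi>\<^sub>1 (\<Gamma> @ [A]) \<Longrightarrow> proves \<pi>\<^sub>2 (\<Delta> @ [B]) \<Longrightarrow> proves \<rho> (\<Theta> @ [dual A, dual B]) \<Longrightarrow>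
    cut_rule
      (Cut (Tensor A B) (TensorR \<pi>\<^sub>1 \<pi>\<^sub>2) (Exch (swap_blocks (length \<Theta>) 1) (ParR \<rho>)))
      (Cut A \<pi>\<^sub>1 (Exch (swap_blocks (length \<Delta> + length \<Theta>) 1)
        (Cut B \<pi>\<^sub>2 (Exch (swap_blocks (length \<Theta> + 1) 1) \<rho>))))"
| cut_plus1_with:
    "proves \<pi> (\<Gamma> @ [A]) \<Longrightarrow> proves \<rho>\<^sub>1 (\<Delta> @ [dual A]) \<Longrightarrow> proves \<rho>\<^sub>2 (\<Delta> @ [dual B]) \<Longrightarrow>
    cut_rule
      (Cut (Plus A B) (PlusR1 B \<pi>) (Exch (swap_blocks (length \<Delta>) 1) (WithR \<rho>\<^sub>1 \<rho>\<^sub>2)))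
      (Cut A \<pi> (Exch (swap_blocks (length \<Delta>) 1) \<rho>\<^sub>1))"
| cut_plus2_with:
    "proves \<pi> (\<Gamma> @ [B]) \<Longrightarrow> proves \<rho>\<^sub>1 (\<Delta> @ [dual A]) \<Longrightarrow> proves \<rho>\<^sub>2 (\<Delta> @ [dual B]) \<Longrightarrow>
    cut_rule
      (Cut (Plus A B) (PlusR2 A \<pi>) (Exch (swap_blocks (length \<Delta>) 1) (WithR \<rho>\<^sub>1 \<rho>\<^sub>2)))
      (Cut B \<pi> (Exch (swap_blocks (length \<Delta>) 1) \<rho>\<^sub>2))"
| cut_bot: "proves \<pi> (\<Gamma> @ [A]) \<Longrightarrow> proves \<rho> (dual A # \<Delta>) \<Longrightarrow>
    cut_rule (Cut A \<pi> (BotR \<rho>)) (BotR (Cut A \<pi> \<rho>))"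
| cut_tensor1:
    "proves \<pi> (\<Gamma> @ [A]) \<Longrightarrow> proves \<rho>\<^sub>1 (dual A # \<Delta> @ [B]) \<Longrightarrow> proves \<rho>\<^sub>2 (\<Theta> @ [C]) \<Longrightarrow>
    cut_rule (Cut A \<pi> (TensorR \<rho>\<^sub>1 \<rho>\<^sub>2)) (TensorR (Cut A \<pi> \<rho>\<^sub>1) \<rho>\<^sub>2)"
| cut_tensor2:
    "proves \<pi> (\<Gamma> @ [A]) \<Longrightarrow> proves \<rho>\<^sub>1 (\<Delta> @ [B]) \<Longrightarrow> proves \<rho>\<^sub>2 (dual A # \<Theta> @ [C]) \<Longrightarrow>
    cut_rule (Cut A \<pi> (Exch (swap_blocks (length \<Delta>) 1) (TensorR \<rho>\<^sub>1 \<rho>\<^sub>2)))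
      (Exch (swap_blocks (length \<Delta>) (length \<Gamma>)) (TensorR \<rho>\<^sub>1 (Cut A \<pi> \<rho>\<^sub>2)))"
| cut_par: "proves \<pi> (\<Gamma> @ [A]) \<Longrightarrow> proves \<rho> (dual A # \<Delta> @ [B, C]) \<Longrightarrow>
    cut_rule (Cut A \<pi> (ParR \<rho>)) (ParR (Cut A \<pi> \<rho>))"
| cut_plus1: "proves \<pi> (\<Gamma> @ [A]) \<Longrightarrow> proves \<rho> (dual A # \<Delta> @ [B]) \<Longrightarrow>
    cut_rule (Cut A \<pi> (PlusR1 C \<rho>)) (PlusR1 C (Cut A \<pi> \<rho>))"
| cut_plus2: "proves \<pi> (\<Gamma> @ [A]) \<Longrightarrow> proves \<rho> (dual A # \<Delta> @ [C]) \<Longrightarrow>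
    cut_rule (Cut A \<pi> (PlusR2 B \<rho>)) (PlusR2 B (Cut A \<pi> \<rho>))"
| cut_with:
    "proves \<pi> (\<Gamma> @ [A]) \<Longrightarrow> proves \<rho>\<^sub>1 (dual A # \<Delta> @ [B]) \<Longrightarrow> proves \<rho>\<^sub>2 (dual A # \<Delta> @ [C]) \<Longrightarrow>
    cut_rule (Cut A \<pi> (WithR \<rho>\<^sub>1 \<rho>\<^sub>2)) (WithR (Cut A \<pi> \<rho>\<^sub>1) (Cut A \<pi> \<rho>\<^sub>2))"
| cut_top: "proves \<pi> (\<Gamma> @ [A]) \<Longrightarrow>
    cut_rule (Cut A \<pi> (TopR (dual A # \<Delta>))) (TopR (\<Gamma> @ \<Delta>))"
| cut_cut:
    "proves \<pi> (\<Gamma> @ [A]) \<Longrightarrow> proves \<rho>\<^sub>1 (dual A # \<Delta> @ [B]) \<Longrightarrow> proves \<rho>\<^sub>2 (dual B # \<Theta>) \<Longrightarrow>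
    cut_rule (Cut A \<pi> (Cut B \<rho>\<^sub>1 \<rho>\<^sub>2)) (Cut B (Cut A \<pi> \<rho>\<^sub>1) \<rho>\<^sub>2)"

text \<open>Expansion of axioms; the dual connectives are obtained with \<open>exch_ax\<close>.\<close>

inductive eta_rule :: "'a derivation \<Rightarrow> 'a derivation \<Rightarrow> bool" where
  eta_one: "eta_rule (Ax One) (Exch (swap_blocks 1 1) (BotR OneR))"
| eta_top: "eta_rule (Ax Top) (TopR [Zero])"
| eta_tensor: "eta_rule (Ax (Tensor A B))
    (Exch (swap_blocks 1 1) (ParR (Exch (swap_blocks 2 1) (TensorR (Ax A) (Ax B)))))"
| eta_with: "eta_rule (Ax (With A B))
    (WithR
      (Exch (swap_blocks 1 1) (PlusR1 (dual B) (Exch (swap_blocks 1 1) (Ax A))))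
      (Exch (swap_blocks 1 1) (PlusR2 (dual A) (Exch (swap_blocks 1 1) (Ax B)))))"

inductive step :: "'a derivation \<Rightarrow> 'a derivation \<Rightarrow> bool" where
  exch_rule: "exch_rule \<pi> \<pi>' \<Longrightarrow> step \<pi> \<pi>'"
| cut_rule: "cut_rule \<pi> \<pi>' \<Longrightarrow> step \<pi> \<pi>'"
| eta_rule: "eta_rule \<pi> \<pi>' \<Longrightarrow> step \<pi> \<pi>'"
| in_cut_left: "step \<pi> \<pi>' \<Longrightarrow> step (Cut A \<pi> \<rho>) (Cut A \<pi>' \<rho>)"
| in_cut_right: "step \<rho> \<rho>' \<Longrightarrow> step (Cut A \<pi> \<rho>) (Cut A \<pi> \<rho>')"
| in_exch: "step \<pi> \<pi>' \<Longrightarrow> step (Exch p \<pi>) (Exch p \<pi>')"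
| in_bot: "step \<pi> \<pi>' \<Longrightarrow> step (BotR \<pi>) (BotR \<pi>')"
| in_tensor_left: "step \<pi> \<pi>' \<Longrightarrow> step (TensorR \<pi> \<rho>) (TensorR \<pi>' \<rho>)"
| in_tensor_right: "step \<rho> \<rho>' \<Longrightarrow> step (TensorR \<pi> \<rho>) (TensorR \<pi> \<rho>')"
| in_par: "step \<pi> \<pi>' \<Longrightarrow> step (ParR \<pi>) (ParR \<pi>')"
| in_plus1: "step \<pi> \<pi>' \<Longrightarrow> step (PlusR1 A \<pi>) (PlusR1 A \<pi>')"
| in_plus2: "step \<pi> \<pi>' \<Longrightarrow> step (PlusR2 A \<pi>) (PlusR2 A \<pi>')"
| in_with_left: "step \<pi> \<pi>' \<Longrightarrow> step (WithR \<pi> \<rho>) (WithR \<pi>' \<rho>)"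
| in_with_right: "step \<rho> \<rho>' \<Longrightarrow> step (WithR \<pi> \<rho>) (WithR \<pi> \<rho>')"

text \<open>
  As usual for type isomorphisms of MALL, reduction to an axiom is taken up to the equivalence
  generated by cut elimination and axiom expansion. A sequence of reduction steps ending in \<open>Ax A\<close>
  is a special case, but a far too narrow one: for
  \<open>A \<otimes> B \<cong> B \<otimes> A\<close> cut elimination only yields an expansion of the axiom, and for
  \<open>A \<otimes> (B \<otimes> C) \<cong> (A \<otimes> B) \<otimes> C\<close> only an expansion up to permuting independent rules.
  The generated equivalence contains these permutations, as they relate different
  cut-elimination results of the same derivation.
\<close>

definition cut_elim_equiv :: "'a derivation \<Rightarrow> 'a derivation \<Rightarrow> bool" where
  "cut_elim_equiv = equivclp step"

definition isomorphic_types :: "'a formula \<Rightarrow> 'a formula \<Rightarrow> bool" where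
  "isomorphic_types A B \<longleftrightarrow> (\<exists>\<pi> \<pi>'.
     proves \<pi> [dual A, B] \<and> proves \<pi>' [dual B, A] \<and>
     cut_elim_equiv (Cut B \<pi> \<pi>') (Ax A) \<and> cut_elim_equiv (Cut A \<pi>' \<pi>) (Ax B))"


section \<open>Relational semantics\<close>

datatype 'p point = Star | Atom 'p | Pair "'p point" "'p point" | In1 "'p point" | In2 "'p point"

fun pts :: "('a \<Rightarrow> 'p set) \<Rightarrow> 'a formula \<Rightarrow> 'p point set" where
  "pts V (Pos a) = Atom ` V a"
| "pts V (Neg a) = Atom ` V a"
| "pts V One = {Star}"
| "pts V Bot = {Star}"
| "pts V Zero = {}"
| "pts V Top = {}"
| "pts V (Tensor A B) = {Pair a b | a b. a \<in> pts V A \<and> b \<in> pts V B}"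
| "pts V (Par A B) = {Pair a b | a b. a \<in> pts V A \<and> b \<in> pts V B}"
| "pts V (Plus A B) = In1 ` pts V A \<union> In2 ` pts V B"
| "pts V (With A B) = In1 ` pts V A \<union> In2 ` pts V B"

lemma pts_dual [simp]: "pts V (dual A) = pts V A"
  by (induction A) auto

text \<open>Tuples of points are lists, so that \<open>\<gamma> @ \<delta>\<close> renders \<open>(\<gamma>, \<delta>)\<close>.\<close>

fun sem :: "('a \<Rightarrow> 'p set) \<Rightarrow> 'a derivation \<Rightarrow> 'p point list set" where
  "sem V (Ax A) = {[a, a] | a. a \<in> pts V A}"
| "sem V (Cut A \<pi> \<rho>) = {\<gamma> @ \<delta> | \<gamma> \<delta>. \<exists>a. \<gamma> @ [a] \<in> sem V \<pi> \<and> a # \<delta> \<in> sem V \<rho>}"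
| "sem V (Exch p \<pi>) = permute_list p ` sem V \<pi>"
| "sem V OneR = {[Star]}"
| "sem V (BotR \<pi>) = {\<gamma> @ [Star] | \<gamma>. \<gamma> \<in> sem V \<pi>}"
| "sem V (TensorR \<pi> \<rho>) = {\<gamma> @ \<delta> @ [Pair a b] | \<gamma> \<delta> a b. \<gamma> @ [a] \<in> sem V \<pi> \<and> \<delta> @ [b] \<in> sem V \<rho>}"
| "sem V (ParR \<pi>) = {\<gamma> @ [Pair a b] | \<gamma> a b. \<gamma> @ [a, b] \<in> sem V \<pi>}"
| "sem V (PlusR1 B \<pi>) = {\<gamma> @ [In1 a] | \<gamma> a. \<gamma> @ [a] \<in> sem V \<pi>}"
| "sem V (PlusR2 A \<pi>) = {\<gamma> @ [In2 b] | \<gamma> b. \<gamma> @ [b] \<in> sem V \<pi>}"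
| "sem V (WithR \<pi> \<rho>) =
     {\<gamma> @ [In1 a] | \<gamma> a. \<gamma> @ [a] \<in> sem V \<pi>} \<union> {\<gamma> @ [In2 b] | \<gamma> b. \<gamma> @ [b] \<in> sem V \<rho>}"
| "sem V (TopR \<Gamma>) = {}"


section \<open>Simplicial complexes\<close>

record 'v complex =
  web :: "'v set"
  simplices :: "'v set set"

definition asc :: "'v complex \<Rightarrow> bool" where
  "asc X \<longleftrightarrow> countable (web X) \<and>
     (\<forall>x \<in> simplices X. finite x \<and> x \<noteq> {} \<and> x \<subseteq> web X) \<and>
     (\<forall>x \<in> simplices X. \<forall>y. y \<noteq> {} \<and> y \<subseteq> x \<longrightarrow> y \<in> simplices X) \<and>
     (\<forall>a \<in> web X. {a} \<in> simplices X)"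

definition union_complex :: "'v complex \<Rightarrow> 'v set complex" where
  "union_complex X =
     \<lparr>web = simplices X,
      simplices = {U. finite U \<and> U \<noteq> {} \<and> U \<subseteq> simplices X \<and> \<Union>U \<in> simplices X}\<rparr>"

definition formula_complex :: "('a \<Rightarrow> 'p set) \<Rightarrow> 'a formula \<Rightarrow> 'p point complex" where
  "formula_complex V A =
     \<lparr>web = pts V A,
      simplices = {x. finite x \<and> x \<noteq> {} \<and> (\<exists>\<pi>. proves \<pi> [A] \<and> (\<forall>a\<in>x. [a] \<in> sem V \<pi>))}\<rparr>"


text \<open>
  \<open>formula_complex V A\<close> may lack some singletons, e.g. when \<open>A\<close> is a literal, but
  \<open>union_complex\<close> only depends on the set of simplices and always yields a complex.
\<close>

lemma list_all2_append_right:
  "list_all2 P xs (ys @ zs) \<longleftrightarrow> (\<exists>us vs. xs = us @ vs \<and> list_all2 P us ys \<and> list_all2 P vs zs)"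
  by (metis list_all2_append2 list_all2_appendI)

lemma sem_typed: "proves \<pi> \<Gamma> \<Longrightarrow> \<gamma> \<in> sem V \<pi> \<Longrightarrow> list_all2 (\<lambda>a A. a \<in> pts V A) \<gamma> \<Gamma>"
proof (induction arbitrary: \<gamma> rule: proves.induct)
  case (exch \<pi> \<Gamma> p)
  then show ?case
    using permutes_in_image[OF exch.hyps(2)]
    by (auto simp: list_all2_conv_all_nth permute_list_nth)
next
  case (with_rule \<pi> \<Gamma> A \<rho> B)
  then show ?case by (fastforce simp: list_all2_append_right list_all2_Cons2)
qed (fastforce simp: list_all2_append_right list_all2_Cons2)+

lemma countable_pts:
  assumes "\<And>\<alpha>. countable (V \<alpha>)"
  shows "countable (pts V A)"
proof (induction A)
  case (Tensor A B)
  have "pts V (Tensor A B) = (\<lambda>(a, b). Pair a b) ` (pts V A \<times> pts V B)" by auto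
  with Tensor show ?case by (metis countable_SIGMA countable_image)
next
  case (Par A B)
  have "pts V (Par A B) = (\<lambda>(a, b). Pair a b) ` (pts V A \<times> pts V B)" by auto
  with Par show ?case by (metis countable_SIGMA countable_image)
qed (auto simp: assms)

lemma asc_union_formula_complex:
  fixes V :: "'a \<Rightarrow> 'p set"
  assumes "\<And>\<alpha>. countable (V \<alpha>)"
  shows "asc (union_complex (formula_complex V A))"
proof -
  let ?S = "simplices (formula_complex V A)"
  have "?S \<subseteq> {x. finite x \<and> x \<subseteq> pts V A}"
    unfolding formula_complex_def by (auto dest: sem_typed)
  then have count: "countable ?S"
    using countable_Collect_finite_subset[OF countable_pts[of V A, OF assms]]
    by (rule countable_subset)
  have down: "y \<in> ?S" if "x \<in> ?S" "y \<subseteq> x" "y \<noteq> {}" for x y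
    using that finite_subset[OF that(2)] unfolding formula_complex_def
    by (simp, meson subsetD)
  have "\<Union>W \<in> ?S" if "\<Union>U \<in> ?S" "U \<subseteq> ?S" "W \<subseteq> U" "W \<noteq> {}" for U W
  proof (rule down[OF that(1)])
    show "\<Union>W \<subseteq> \<Union>U" using that(3) by (rule Union_mono)
    have "{} \<notin> ?S" by (simp add: formula_complex_def)
    with that(2,3,4) show "\<Union>W \<noteq> {}" by (metis Union_empty_conv ex_in_conv subsetD)
  qed
  moreover have "finite W" if "finite U" "W \<subseteq> U" for U W :: "'p point set set"
    using that by (rule rev_finite_subset)
  moreover have "W \<subseteq> ?S" if "U \<subseteq> ?S" "W \<subseteq> U" for U W
    using that by (rule order_trans[rotated])
  ultimately show ?thesis
    using count unfolding asc_def union_complex_def by (simp, blast)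
qed


section \<open>Simplicial homology with integer coefficients\<close>

text \<open>
  The oriented \<open>k\<close>-chains are the free abelian group on the \<open>k\<close>-simplices listed in some order,
  modulo the identification of a reordering with its sign times the original list.
\<close>

definition ordered_simplices :: "'v complex \<Rightarrow> nat \<Rightarrow> 'v list set" where
  "ordered_simplices X k = {vs. length vs = Suc k \<and> distinct vs \<and> set vs \<in> simplices X}"

definition free_chains :: "'v complex \<Rightarrow> nat \<Rightarrow> ('v list \<Rightarrow>\<^sub>0 int) monoid" where
  "free_chains X k = free_Abelian_group (ordered_simplices X k)"

definition orientation_rels :: "'v complex \<Rightarrow> nat \<Rightarrow> ('v list \<Rightarrow>\<^sub>0 int) set" where
  "orientation_rels X k = generate (free_chains X k)
     {frag_of (permute_list p vs) - frag_cmul (sign p) (frag_of vs) | p vs.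
        vs \<in> ordered_simplices X k \<and> p permutes {..<Suc k}}"

definition chains :: "'v complex \<Rightarrow> nat \<Rightarrow> ('v list \<Rightarrow>\<^sub>0 int) set monoid" where
  "chains X k = free_chains X k Mod orientation_rels X k"

definition free_boundary :: "('v list \<Rightarrow>\<^sub>0 int) \<Rightarrow> ('v list \<Rightarrow>\<^sub>0 int)" where
  "free_boundary = frag_extend
     (\<lambda>vs. \<Sum>i<length vs. frag_cmul ((- 1) ^ i) (frag_of (take i vs @ drop (Suc i) vs)))"

text \<open>
  The map from \<open>Suc k\<close>-chains to \<open>k\<close>-chains induced on cosets; all elements of a coset are sent
  to the same coset, so the union is that single coset.
\<close>

definition boundary :: "'v complex \<Rightarrow> nat \<Rightarrow> ('v list \<Rightarrow>\<^sub>0 int) set \<Rightarrow> ('v list \<Rightarrow>\<^sub>0 int) set" where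
  "boundary X k c = (\<Union>x\<in>c. orientation_rels X k #>\<^bsub>free_chains X k\<^esub> free_boundary x)"

fun cycles :: "'v complex \<Rightarrow> nat \<Rightarrow> ('v list \<Rightarrow>\<^sub>0 int) set set" where
  "cycles X 0 = carrier (chains X 0)"
| "cycles X (Suc k) = kernel (chains X (Suc k)) (chains X k) (boundary X k)"

definition boundaries :: "'v complex \<Rightarrow> nat \<Rightarrow> ('v list \<Rightarrow>\<^sub>0 int) set set" where
  "boundaries X k = boundary X k ` carrier (chains X (Suc k))"

definition homology :: "'v complex \<Rightarrow> nat \<Rightarrow> ('v list \<Rightarrow>\<^sub>0 int) set set monoid" where
  "homology X k = (chains X k)\<lparr>carrier := cycles X k\<rparr> Mod boundaries X k"

end

theory Submission
  imports Defs
begin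

text \<open>
  The relational semantics is invariant under cut elimination and axiom expansion. Hence the
  relations denoted
    by \<open>\<pi>\<close> and \<open>\<pi>\<^sup>-\<^sup>1\<close> compose to identities on both sides, which makes them mutually inverse
  bijections between \<open>|A|\<close> and \<open>|B|\<close>. Cutting a proof of \<open>A\<close> against \<open>\<pi>\<close> takes the image of its
  interpretation under the bijection, so direct images identify the simplices of \<open>[A]\<close> with those
  of \<open>[B]\<close>, and therefore the complexes built from them, vertex by vertex.
\<close>

section \<open>Permutations of concatenated lists\<close>

text \<open>Two difficulties shape the proof. Tuples of points are plain lists, so a cut or a tensor
  is a set of concatenations, and comparing two of them means splitting an equation such as
  \<open>a # xs = \<gamma> @ \<delta>\<close> at the right place. The \<open>proves\<close> premises
  of the reduction rules fix the lengths of all tuples and thereby the splits; exchanges, whose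
  permutations have the block sizes built in, need the same information.

  The bijection comes from a choice, so it is known to be injective only on \<open>pts V A\<close>.
  Quotients are sets of cosets, so each map induced on a quotient is literally the direct image
  under the map before it: \<open>image f\<close> on the vertices of the union complexes,
  \<open>frag_map\<close> of this on free chains, its direct image on oriented chains, and the
  direct image of that on homology classes. A direct image is injective only on the subsets of a set
  where the map itself is, which is why carriers, relations, cycles and boundaries are bounded at
  every level.\<close>

lemma permute_list_swap_blocks:
  assumes "length xs = n" "length ys = m"
  shows "permute_list (swap_blocks n m) (xs @ ys @ zs) = ys @ xs @ zs"
proof (rule nth_equalityI)
qed (use assms in \<open>auto simp: permute_list_def swap_blocks_def nth_append add.commute\<close>)

lemma permute_list_juxt:
  assumes "p permutes {..<length xs}"
  shows "permute_list (juxt (length xs) p q) (xs @ ys) = permute_list p xs @ permute_list q ys"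
proof (rule nth_equalityI)
  fix i assume "i < length (permute_list (juxt (length xs) p q) (xs @ ys))"
  then show "permute_list (juxt (length xs) p q) (xs @ ys) ! i = (permute_list p xs @ permute_list q ys) ! i"
    using permutes_in_image[OF assms, of i]
    by (auto simp: permute_list_def juxt_def nth_append)
qed simp

text \<open>In \<open>p permutes {..<length xs}\<close> the positions after \<open>xs\<close> are
  fixed, so exchanging a context leaves the formulas behind it in place.\<close>

lemma permute_list_append:
  assumes "p permutes {..<length xs}"
  shows "permute_list p (xs @ ys) = permute_list p xs @ ys"
proof (rule nth_equalityI)
  fix i assume "i < length (permute_list p (xs @ ys))"
  then show "permute_list p (xs @ ys) ! i = (permute_list p xs @ ys) ! i"
    using permutes_in_image[OF assms, of i] permutes_not_in[OF assms, of i]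
    by (auto simp: permute_list_def nth_append)
qed simp

text \<open>\<open>permute_list\<close> preserves length, so a preimage of
  \<open>ys @ xs @ zs\<close> can be cut into blocks of sizes \<open>n\<close>, \<open>m\<close> and
  \<open>length zs\<close>, and the blocks are then identified one by one.\<close>

lemma image_swap_blocks_iff:
  assumes "length xs = n" "length ys = m"
  shows "ys @ xs @ zs \<in> permute_list (swap_blocks n m) ` S \<longleftrightarrow> xs @ ys @ zs \<in> S"
proof
  assume "ys @ xs @ zs \<in> permute_list (swap_blocks n m) ` S"
  then obtain ws where ws: "ws \<in> S" "ys @ xs @ zs = permute_list (swap_blocks n m) ws" by auto
  have l: "length ws = n + m + length zs" using arg_cong[OF ws(2), of length] assms by simp
  define us where "us = take n ws"
  define vs where "vs = take m (drop n ws)"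
  define ts where "ts = drop (n + m) ws"
  have split: "ws = us @ vs @ ts"
    by (simp add: us_def vs_def ts_def add.commute flip: drop_drop)
  have "length us = n" "length vs = m" using l by (simp_all add: us_def vs_def)
  then have "ys @ xs @ zs = vs @ us @ ts" using ws(2) unfolding split
    by (simp add: permute_list_swap_blocks)
  then have "ys = vs" "xs = us" "zs = ts" using assms \<open>length us = n\<close> \<open>length vs = m\<close> by auto
  then show "xs @ ys @ zs \<in> S" using ws(1) split by simp
next
  assume "xs @ ys @ zs \<in> S"
  then show "ys @ xs @ zs \<in> permute_list (swap_blocks n m) ` S"
    using permute_list_swap_blocks[OF assms] by (metis imageI)
qed

text \<open>This rotation brings the principal formula, last in its rule, to the front, where the
  right premise of a cut expects it. The length hypothesis settles tuples \<open>xs\<close> of the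
  wrong size: then neither side holds.\<close>

lemma image_swap_blocks_Cons:
  assumes "\<And>zs. zs \<in> S \<Longrightarrow> length zs = Suc n"
  shows "y # xs \<in> permute_list (swap_blocks n 1) ` S \<longleftrightarrow> xs @ [y] \<in> S"
proof (cases "length xs = n")
  case True
  then show ?thesis using image_swap_blocks_iff[of xs n "[y]" 1 "[]"] by simp
next
  case False
  then have "y # xs \<noteq> permute_list (swap_blocks n 1) zs" if "zs \<in> S" for zs
    using assms[OF that] by (metis length_Cons length_permute_list nat.inject)
  moreover have "xs @ [y] \<notin> S" using False assms[of "xs @ [y]"] by auto
  ultimately show ?thesis by auto
qed

lemma image_swap_blocks_snoc:
  assumes "\<And>zs. zs \<in> S \<Longrightarrow> length zs = Suc n"
  shows "xs @ [y] \<in> permute_list (swap_blocks 1 n) ` S \<longleftrightarrow> y # xs \<in> S"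
proof (cases "length xs = n")
  case True
  then show ?thesis using image_swap_blocks_iff[of "[y]" 1 xs n "[]" S] by simp
next
  case False
  then have "xs @ [y] \<noteq> permute_list (swap_blocks 1 n) zs" if "zs \<in> S" for zs
    using assms[OF that] by (metis length_append_singleton length_permute_list nat.inject)
  moreover have "y # xs \<notin> S" using False assms[of "y # xs"] by auto
  ultimately show ?thesis by auto
qed

lemma image_permute_list_append:
  assumes "\<And>zs. zs \<in> S \<Longrightarrow> length zs = n + length ys" "p permutes {..<n}"
  shows "xs @ ys \<in> permute_list p ` S \<longleftrightarrow> (\<exists>zs. xs = permute_list p zs \<and> zs @ ys \<in> S)"
proof
  assume "xs @ ys \<in> permute_list p ` S"
  then obtain ws where ws: "ws \<in> S" "xs @ ys = permute_list p ws" by auto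
  have l: "length ws = n + length ys" using assms(1)[OF ws(1)] .
  have "permute_list p (take n ws @ drop n ws) = permute_list p (take n ws) @ drop n ws"
    using l assms(2) by (intro permute_list_append) simp
  then have "xs = permute_list p (take n ws)" "ys = drop n ws"
    using ws(2) l by (auto simp: append_eq_append_conv)
  then show "\<exists>zs. xs = permute_list p zs \<and> zs @ ys \<in> S"
    using ws(1) by (metis append_take_drop_id)
next
  assume "\<exists>zs. xs = permute_list p zs \<and> zs @ ys \<in> S"
  then obtain zs where zs: "xs = permute_list p zs" "zs @ ys \<in> S" by blast
  have "length zs = n" using assms(1)[OF zs(2)] by simp
  then have "xs @ ys = permute_list p (zs @ ys)" using assms(2) zs(1)
    by (simp add: permute_list_append)
  then show "xs @ ys \<in> permute_list p ` S" using zs(2) by blast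
qed

lemma image_juxt_Cons:
  "a # xs \<in> permute_list (juxt (Suc 0) id q) ` S \<longleftrightarrow> (\<exists>zs. xs = permute_list q zs \<and> a # zs \<in> S)"
proof -
  have *: "permute_list (juxt (Suc 0) id q) (b # zs) = b # permute_list q zs" for b :: 'a and zs
    using permute_list_juxt[of id "[b]" q zs] by simp
  have "a # xs = permute_list (juxt (Suc 0) id q) zs \<longleftrightarrow> (\<exists>ws. zs = a # ws \<and> xs = permute_list q ws)"
    for zs
    by (cases zs) (auto simp: *)
  then show ?thesis by (auto simp: image_iff)
qed

text \<open>The plus and with rules differ semantically only in the injection put on the last point,
  so \<open>f\<close> stands for \<open>In1\<close> or \<open>In2\<close>.\<close>

lemma image_permute_list_map_last:
  assumes "\<And>zs. zs \<in> S \<Longrightarrow> length zs = Suc n" "p permutes {..<n}"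
  shows "permute_list p ` {\<gamma> @ [f a] | \<gamma> a. \<gamma> @ [a] \<in> S} = {\<gamma> @ [f a] | \<gamma> a. \<gamma> @ [a] \<in> permute_list p ` S}"
proof -
  have snoc: "\<gamma> @ [a] \<in> permute_list p ` S \<longleftrightarrow> (\<exists>\<gamma>'. \<gamma> = permute_list p \<gamma>' \<and> \<gamma>' @ [a] \<in> S)" for \<gamma> a
    using assms by (intro image_permute_list_append) auto
  have "permute_list p (\<gamma> @ [c]) = permute_list p \<gamma> @ [c]" if "\<gamma> @ [a] \<in> S" for \<gamma> a c
    using assms(1)[OF that] assms(2) by (intro permute_list_append) simp
  then have "permute_list p ` {\<gamma> @ [f a] | \<gamma> a. \<gamma> @ [a] \<in> S} = {permute_list p \<gamma> @ [f a] | \<gamma> a. \<gamma> @ [a] \<in> S}"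
    by (force simp: image_iff)
  then show ?thesis unfolding snoc by blast
qed

section \<open>Invariance of the relational semantics\<close>

lemma length_sem: "proves \<pi> \<Gamma> \<Longrightarrow> \<gamma> \<in> sem V \<pi> \<Longrightarrow> length \<gamma> = length \<Gamma>"
  by (rule list_all2_lengthD[OF sem_typed])

text \<open>Every tuple \<open>a # \<delta>\<close> of the right premise is longer than
  \<open>ys\<close>, so the suffix \<open>ys\<close> cannot reach back into the left context and
  must lie inside \<open>\<delta>\<close>.\<close>

lemma sem_Cut_append:
  assumes "\<And>\<delta>. \<delta> \<in> sem V \<rho> \<Longrightarrow> length ys < length \<delta>"
  shows "xs @ ys \<in> sem V (Cut A \<pi> \<rho>) \<longleftrightarrow>
    (\<exists>\<gamma> \<delta> a. xs = \<gamma> @ \<delta> \<and> \<gamma> @ [a] \<in> sem V \<pi> \<and> a # \<delta> @ ys \<in> sem V \<rho>)"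
proof
  assume "xs @ ys \<in> sem V (Cut A \<pi> \<rho>)"
  then obtain \<gamma> \<delta> a where *: "xs @ ys = \<gamma> @ \<delta>" "\<gamma> @ [a] \<in> sem V \<pi>" "a # \<delta> \<in> sem V \<rho>" by auto
  have "length ys \<le> length \<delta>" using assms[OF *(3)] by simp
  then obtain \<delta>' where "xs = \<gamma> @ \<delta>'" "\<delta> = \<delta>' @ ys"
    using *(1) unfolding append_eq_append_conv2 by auto
  then show "\<exists>\<gamma> \<delta> a. xs = \<gamma> @ \<delta> \<and> \<gamma> @ [a] \<in> sem V \<pi> \<and> a # \<delta> @ ys \<in> sem V \<rho>"
    using *(2,3) by blast
next
  assume "\<exists>\<gamma> \<delta> a. xs = \<gamma> @ \<delta> \<and> \<gamma> @ [a] \<in> sem V \<pi> \<and> a # \<delta> @ ys \<in> sem V \<rho>"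
  then show "xs @ ys \<in> sem V (Cut A \<pi> \<rho>)"
    by (metis (mono_tags, lifting) append_assoc mem_Collect_eq sem.simps(2))
qed

lemma sem_exch_rule: "exch_rule \<pi> \<pi>' \<Longrightarrow> sem V \<pi> = sem V \<pi>'"
proof (induction rule: exch_rule.induct)
  case (exch_id \<pi> \<Gamma>)
  show ?case by simp
next
  case (exch_comp \<pi> \<Gamma> p q)
  have "permute_list p (permute_list q \<gamma>) = permute_list (q \<circ> p) \<gamma>" if "\<gamma> \<in> sem V \<pi>" for \<gamma>
    using that exch_comp length_sem by (metis permute_list_compose)
  then show ?case by (simp add: image_image)
next
  case (exch_ax A)
  have "permute_list (swap_blocks 1 1) [a, a] = [a, a]" for a :: "'b point"
    using permute_list_swap_blocks[of "[a]" 1 "[a]" 1 "[]"] by simp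
  then show ?case by (force simp: image_iff)
next
  case (exch_cut_sym \<pi> \<Gamma> A \<rho> \<Delta>)
  have \<pi>: "a # \<gamma> \<in> permute_list (swap_blocks (length \<Gamma>) 1) ` sem V \<pi> \<longleftrightarrow> \<gamma> @ [a] \<in> sem V \<pi>" for a \<gamma>
    using length_sem[OF exch_cut_sym(1), of _ V] by (intro image_swap_blocks_Cons) auto
  have \<rho>: "\<delta> @ [a] \<in> permute_list (swap_blocks 1 (length \<Delta>)) ` sem V \<rho> \<longleftrightarrow> a # \<delta> \<in> sem V \<rho>" for a \<delta>
    using length_sem[OF exch_cut_sym(2), of _ V] by (intro image_swap_blocks_snoc) auto
  have swap: "permute_list (swap_blocks (length \<Gamma>) (length \<Delta>)) (\<gamma> @ \<delta>) = \<delta> @ \<gamma>"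
    if "\<gamma> @ [a] \<in> sem V \<pi>" "a # \<delta> \<in> sem V \<rho>" for a \<gamma> \<delta>
    using length_sem[OF exch_cut_sym(1) that(1)] length_sem[OF exch_cut_sym(2) that(2)]
      permute_list_swap_blocks[of \<gamma> _ \<delta> _ "[]"] by simp
  \<comment> \<open>Both sides are compared through this set, indexed by the tuples of the
    unpermuted premises.\<close>
  have "sem V (Exch (swap_blocks (length \<Gamma>) (length \<Delta>)) (Cut A \<pi> \<rho>)) =
      {\<delta> @ \<gamma> | \<gamma> \<delta>. \<exists>a. \<gamma> @ [a] \<in> sem V \<pi> \<and> a # \<delta> \<in> sem V \<rho>}"
    by (force simp: image_iff swap)
  also have "\<dots> = sem V (Cut (dual A) (Exch (swap_blocks 1 (length \<Delta>)) \<rho>) (Exch (swap_blocks (length \<Gamma>) 1) \<pi>))"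
    unfolding sem.simps \<pi> \<rho> by blast
  finally show ?case .
next
  case (exch_cut \<pi> \<Gamma> A \<rho> \<Delta> p q)
  have \<pi>: "\<gamma> @ [a] \<in> permute_list p ` sem V \<pi> \<longleftrightarrow> (\<exists>\<gamma>'. \<gamma> = permute_list p \<gamma>' \<and> \<gamma>' @ [a] \<in> sem V \<pi>)"
    for \<gamma> a
    using length_sem[OF exch_cut(1), of _ V] exch_cut(3) by (intro image_permute_list_append) auto
  have juxt: "permute_list (juxt (length \<Gamma>) p q) (\<gamma> @ \<delta>) = permute_list p \<gamma> @ permute_list q \<delta>"
    if "\<gamma> @ [a] \<in> sem V \<pi>" for \<gamma> a \<delta>
    using length_sem[OF exch_cut(1) that] exch_cut(3) permute_list_juxt[of p \<gamma> q \<delta>] by simp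
  have "sem V (Exch (juxt (length \<Gamma>) p q) (Cut A \<pi> \<rho>)) =
    {permute_list p \<gamma> @ permute_list q \<delta> | \<gamma> \<delta>. \<exists>a. \<gamma> @ [a] \<in> sem V \<pi> \<and> a # \<delta> \<in> sem V \<rho>}"
    by (force simp: image_iff juxt)
  also have "\<dots> = sem V (Cut A (Exch p \<pi>) (Exch (juxt 1 id q) \<rho>))"
    unfolding sem.simps \<pi> One_nat_def image_juxt_Cons by blast
  finally show ?case .
next
  case (exch_bot \<pi> \<Gamma> p)
  have "permute_list p (\<gamma> @ [Star]) = permute_list p \<gamma> @ [Star]" if "\<gamma> \<in> sem V \<pi>" for \<gamma>
    using length_sem[OF exch_bot(1) that] exch_bot(2) by (simp add: permute_list_append)
  then show ?case by (auto simp: image_iff) metis+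
next
  case (exch_tensor \<pi> \<Gamma> A \<rho> \<Delta> B p q)
  have \<pi>: "\<gamma> @ [a] \<in> permute_list p ` sem V \<pi> \<longleftrightarrow> (\<exists>\<gamma>'. \<gamma> = permute_list p \<gamma>' \<and> \<gamma>' @ [a] \<in> sem V \<pi>)"
    for \<gamma> a
    using length_sem[OF exch_tensor(1), of _ V] exch_tensor(3)
    by (intro image_permute_list_append) auto
  have \<rho>: "\<gamma> @ [a] \<in> permute_list q ` sem V \<rho> \<longleftrightarrow> (\<exists>\<gamma>'. \<gamma> = permute_list q \<gamma>' \<and> \<gamma>' @ [a] \<in> sem V \<rho>)"
    for \<gamma> a
    using length_sem[OF exch_tensor(2), of _ V] exch_tensor(4)
    by (intro image_permute_list_append) auto
  have juxt: "permute_list (juxt (length \<Gamma>) p q) (\<gamma> @ \<delta> @ [c]) = permute_list p \<gamma> @ permute_list q \<delta> @ [c]"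
    if "\<gamma> @ [a] \<in> sem V \<pi>" "\<delta> @ [b] \<in> sem V \<rho>" for \<gamma> a \<delta> b c
    using length_sem[OF exch_tensor(1) that(1)] length_sem[OF exch_tensor(2) that(2)] exch_tensor(3,4)
      permute_list_juxt[of p \<gamma> q "\<delta> @ [c]"] by (simp add: permute_list_append)
  have "sem V (Exch (juxt (length \<Gamma>) p q) (TensorR \<pi> \<rho>)) =
    {permute_list p \<gamma> @ permute_list q \<delta> @ [Pair a b] | \<gamma> \<delta> a b. \<gamma> @ [a] \<in> sem V \<pi> \<and> \<delta> @ [b] \<in> sem V \<rho>}"
    by (force simp: image_iff juxt)
  also have "\<dots> = sem V (TensorR (Exch p \<pi>) (Exch q \<rho>))"
    unfolding sem.simps \<pi> \<rho> by blast
  finally show ?case .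
next
  case (exch_par \<pi> \<Gamma> A B p)
  have "\<gamma> @ [a, b] \<in> permute_list p ` sem V \<pi> \<longleftrightarrow> (\<exists>\<gamma>'. \<gamma> = permute_list p \<gamma>' \<and> \<gamma>' @ [a, b] \<in> sem V \<pi>)"
    for \<gamma> a b
    using length_sem[OF exch_par(1), of _ V] exch_par(2) by (intro image_permute_list_append) auto
  moreover have "permute_list p (\<gamma> @ [c]) = permute_list p \<gamma> @ [c]" if "\<gamma> @ [a, b] \<in> sem V \<pi>"
    for \<gamma> a b c
    using length_sem[OF exch_par(1) that] exch_par(2) by (simp add: permute_list_append)
  ultimately show ?case by (auto simp: image_iff) metis+
next
  case (exch_plus1 \<pi> \<Gamma> A p B)
  show ?case unfolding sem.simps
    using length_sem[OF exch_plus1(1), of _ V] exch_plus1(2)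
    by (intro image_permute_list_map_last) auto
next
  case (exch_plus2 \<pi> \<Gamma> B p A)
  show ?case unfolding sem.simps
    using length_sem[OF exch_plus2(1), of _ V] exch_plus2(2)
    by (intro image_permute_list_map_last) auto
next
  case (exch_with \<pi> \<Gamma> A \<rho> B p)
  have "permute_list p ` {\<gamma> @ [In1 a] | \<gamma> a. \<gamma> @ [a] \<in> sem V \<pi>} =
      {\<gamma> @ [In1 a] | \<gamma> a. \<gamma> @ [a] \<in> permute_list p ` sem V \<pi>}"
    using length_sem[OF exch_with(1), of _ V] exch_with(3)
    by (intro image_permute_list_map_last) auto
  moreover have "permute_list p ` {\<gamma> @ [In2 a] | \<gamma> a. \<gamma> @ [a] \<in> sem V \<rho>} =
      {\<gamma> @ [In2 a] | \<gamma> a. \<gamma> @ [a] \<in> permute_list p ` sem V \<rho>}"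
    using length_sem[OF exch_with(2), of _ V] exch_with(3)
    by (intro image_permute_list_map_last) auto
  ultimately show ?case by (simp only: sem.simps image_Un)
next
  case (exch_top p \<Gamma>)
  show ?case by simp
qed

section \<open>Key and commutative cut reductions\<close>

lemma sem_TensorR_Cons:
  assumes "\<And>\<gamma>. \<gamma> \<in> sem V \<rho>\<^sub>1 \<Longrightarrow> Suc 0 < length \<gamma>"
  shows "a # xs \<in> sem V (TensorR \<rho>\<^sub>1 \<rho>\<^sub>2) \<longleftrightarrow>
    (\<exists>\<delta> \<theta> b c. xs = \<delta> @ \<theta> @ [Pair b c] \<and> a # \<delta> @ [b] \<in> sem V \<rho>\<^sub>1 \<and> \<theta> @ [c] \<in> sem V \<rho>\<^sub>2)"
proof
  assume "a # xs \<in> sem V (TensorR \<rho>\<^sub>1 \<rho>\<^sub>2)"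
  then obtain \<delta> \<theta> b c where *: "a # xs = \<delta> @ \<theta> @ [Pair b c]" "\<delta> @ [b] \<in> sem V \<rho>\<^sub>1" "\<theta> @ [c] \<in> sem V \<rho>\<^sub>2"
    by auto
  \<comment> \<open>With at least two entries in every left tuple, the head \<open>a\<close> belongs
    to the left context and is neither a point of \<open>\<theta>\<close> nor the pair
    itself.\<close>
  then have "\<delta> \<noteq> []" using assms[OF *(2)] by auto
  then obtain \<delta>' where "\<delta> = a # \<delta>'" using *(1) by (cases \<delta>) auto
  then show "\<exists>\<delta> \<theta> b c. xs = \<delta> @ \<theta> @ [Pair b c] \<and> a # \<delta> @ [b] \<in> sem V \<rho>\<^sub>1 \<and> \<theta> @ [c] \<in> sem V \<rho>\<^sub>2"
    using * by auto
next
  assume "\<exists>\<delta> \<theta> b c. xs = \<delta> @ \<theta> @ [Pair b c] \<and> a # \<delta> @ [b] \<in> sem V \<rho>\<^sub>1 \<and> \<theta> @ [c] \<in> sem V \<rho>\<^sub>2"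
  then obtain \<delta> \<theta> b c where "a # xs = (a # \<delta>) @ \<theta> @ [Pair b c]" "(a # \<delta>) @ [b] \<in> sem V \<rho>\<^sub>1" "\<theta> @ [c] \<in> sem V \<rho>\<^sub>2"
    by auto
  then show "a # xs \<in> sem V (TensorR \<rho>\<^sub>1 \<rho>\<^sub>2)" unfolding sem.simps by blast
qed

lemma map_last_Cons:
  assumes "\<And>\<gamma>. \<gamma> \<in> S \<Longrightarrow> Suc 0 < length \<gamma>"
  shows "a # xs \<in> {\<gamma> @ [f b] | \<gamma> b. \<gamma> @ [b] \<in> S} \<longleftrightarrow> (\<exists>\<delta> b. xs = \<delta> @ [f b] \<and> a # \<delta> @ [b] \<in> S)"
proof
  assume "a # xs \<in> {\<gamma> @ [f b] | \<gamma> b. \<gamma> @ [b] \<in> S}"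
  then obtain \<gamma> b where *: "a # xs = \<gamma> @ [f b]" "\<gamma> @ [b] \<in> S" by blast
  with assms[OF *(2)] show "\<exists>\<delta> b. xs = \<delta> @ [f b] \<and> a # \<delta> @ [b] \<in> S" by (cases \<gamma>) auto
qed (auto simp flip: append_Cons)

text \<open>Every tuple of \<open>\<rho>\<close> has length at least two, so the cut point at its
  head and the point tagged by \<open>f\<close> at its end are different entries and the two
  operations commute.\<close>

lemma cut_map_last:
  assumes "\<And>\<delta>. \<delta> \<in> sem V \<rho> \<Longrightarrow> Suc 0 < length \<delta>"
  shows "{\<gamma> @ \<delta> | \<gamma> \<delta>. \<exists>a. \<gamma> @ [a] \<in> sem V \<pi> \<and> a # \<delta> \<in> {\<delta> @ [f b] | \<delta> b. \<delta> @ [b] \<in> sem V \<rho>}} =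
    {\<gamma> @ [f b] | \<gamma> b. \<gamma> @ [b] \<in> sem V (Cut A \<pi> \<rho>)}"
proof -
  have "xs @ [b] \<in> sem V (Cut A \<pi> \<rho>) \<longleftrightarrow>
      (\<exists>\<gamma> \<delta> a. xs = \<gamma> @ \<delta> \<and> \<gamma> @ [a] \<in> sem V \<pi> \<and> a # \<delta> @ [b] \<in> sem V \<rho>)" for xs b
    using assms by (intro sem_Cut_append) simp
  moreover have "a # \<delta> \<in> {\<delta> @ [f b] | \<delta> b. \<delta> @ [b] \<in> sem V \<rho>} \<longleftrightarrow>
      (\<exists>\<delta>' b. \<delta> = \<delta>' @ [f b] \<and> a # \<delta>' @ [b] \<in> sem V \<rho>)" for a \<delta>
    using assms by (rule map_last_Cons)
  ultimately show ?thesis by (simp only:) fastforce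
qed

text \<open>Key rules take the common composite point apart into the points on which the smaller
  cuts meet; commutative rules act on entries other than the cut point.\<close>

lemma sem_cut_rule: "cut_rule \<pi> \<pi>' \<Longrightarrow> sem V \<pi> = sem V \<pi>'"
proof (induction rule: cut_rule.induct)
  case (cut_ax_right \<pi> \<Gamma> A)
  then show ?case using sem_typed[OF cut_ax_right]
    by (auto simp: list_all2_append_right list_all2_Cons2) fastforce
next
  case (cut_ax_left \<rho> A \<Delta>)
  have "x \<in> sem V (Cut A (Ax A) \<rho>)" if x: "x \<in> sem V \<rho>" for x
  proof -
    obtain a xs where "x = [a] @ xs" "a \<in> pts V A"
      using sem_typed[OF cut_ax_left x] by (auto simp: list_all2_Cons2)
    moreover from this have "[a] @ [a] \<in> sem V (Ax A)" "a # xs \<in> sem V \<rho>" using x by auto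
    ultimately show ?thesis unfolding sem.simps(2) by blast
  qed
  then show ?case by auto
next
  case (cut_one_bot \<rho> \<Delta>)
  have "a # xs \<in> permute_list (swap_blocks (length \<Delta>) 1) ` sem V (BotR \<rho>) \<longleftrightarrow> xs @ [a] \<in> sem V (BotR \<rho>)"
    for a xs
    using length_sem[OF cut_one_bot] by (intro image_swap_blocks_Cons) auto
  then show ?case by auto
next
  case (cut_tensor_par \<pi>\<^sub>1 \<Gamma> A \<pi>\<^sub>2 \<Delta> B \<rho> \<Theta>)
  let ?\<rho> = "Exch (swap_blocks (length \<Theta> + 1) 1) \<rho>"
  let ?\<sigma> = "Cut B \<pi>\<^sub>2 ?\<rho>"
  have len: "length \<theta> = length \<Theta> + 2" if "\<theta> \<in> sem V \<rho>" for \<theta>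
    using length_sem[OF cut_tensor_par(3) that] by simp
  have par: "c # xs \<in> sem V (Exch (swap_blocks (length \<Theta>) 1) (ParR \<rho>)) \<longleftrightarrow> xs @ [c] \<in> sem V (ParR \<rho>)"
    for c xs
    unfolding sem.simps(3) by (intro image_swap_blocks_Cons) (auto dest: len)
  have \<rho>: "b # xs \<in> sem V ?\<rho> \<longleftrightarrow> xs @ [b] \<in> sem V \<rho>" for b xs
    unfolding sem.simps(3) by (intro image_swap_blocks_Cons) (auto dest: len)
  have \<sigma>: "xs @ [a] \<in> sem V ?\<sigma> \<longleftrightarrow>
     (\<exists>\<delta> \<theta> b. xs = \<delta> @ \<theta> \<and> \<delta> @ [b] \<in> sem V \<pi>\<^sub>2 \<and> b # \<theta> @ [a] \<in> sem V ?\<rho>)" for xs a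
    by (intro sem_Cut_append) (auto dest: len)
  \<comment> \<open>The exchange around the inner cut has its block size built in, so the tuples of
    that cut must be shown to have exactly this length.\<close>
  have "length zs = Suc (length \<Delta> + length \<Theta>)" if zs: "zs \<in> sem V ?\<sigma>" for zs
  proof -
    obtain \<gamma> \<delta> b where z: "zs = \<gamma> @ \<delta>" "\<gamma> @ [b] \<in> sem V \<pi>\<^sub>2" "\<delta> @ [b] \<in> sem V \<rho>"
      using zs unfolding sem.simps(2) \<rho> by blast
    then show ?thesis using length_sem[OF cut_tensor_par(2) z(2)] len[OF z(3)] by simp
  qed
  then have rot: "a # xs \<in> sem V (Exch (swap_blocks (length \<Delta> + length \<Theta>) 1) ?\<sigma>) \<longleftrightarrow> xs @ [a] \<in> sem V ?\<sigma>"
    for a xs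
    unfolding sem.simps(3)[of _ _ ?\<sigma>] by (intro image_swap_blocks_Cons) auto
  have "\<gamma> @ [c] \<in> sem V (TensorR \<pi>\<^sub>1 \<pi>\<^sub>2) \<longleftrightarrow>
      (\<exists>\<gamma>' \<delta> a b. \<gamma> = \<gamma>' @ \<delta> \<and> c = Pair a b \<and> \<gamma>' @ [a] \<in> sem V \<pi>\<^sub>1 \<and> \<delta> @ [b] \<in> sem V \<pi>\<^sub>2)" for \<gamma> c
    unfolding sem.simps(6) append_assoc[symmetric] append1_eq_conv mem_Collect_eq by blast
  moreover have "\<theta> @ [c] \<in> sem V (ParR \<rho>) \<longleftrightarrow> (\<exists>a b. c = Pair a b \<and> \<theta> @ [a, b] \<in> sem V \<rho>)" for \<theta> c
    unfolding sem.simps(7) append1_eq_conv mem_Collect_eq by blast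
  \<comment> \<open>A point shared by the tensor and the par is a pair, and sharing it amounts to
    sharing both components separately.\<close>
  ultimately have key: "(\<exists>c. \<gamma> @ [c] \<in> sem V (TensorR \<pi>\<^sub>1 \<pi>\<^sub>2) \<and> \<theta> @ [c] \<in> sem V (ParR \<rho>)) \<longleftrightarrow>
      (\<exists>\<gamma>' \<delta> a b. \<gamma> = \<gamma>' @ \<delta> \<and> \<gamma>' @ [a] \<in> sem V \<pi>\<^sub>1 \<and> \<delta> @ [b] \<in> sem V \<pi>\<^sub>2 \<and> \<theta> @ [a, b] \<in> sem V \<rho>)" for \<gamma> \<theta>
    by (simp only:) blast
  have "sem V (Cut (Tensor A B) (TensorR \<pi>\<^sub>1 \<pi>\<^sub>2) (Exch (swap_blocks (length \<Theta>) 1) (ParR \<rho>))) =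
    {\<gamma> @ \<delta> @ \<theta> | \<gamma> \<delta> \<theta>. \<exists>a b. \<gamma> @ [a] \<in> sem V \<pi>\<^sub>1 \<and> \<delta> @ [b] \<in> sem V \<pi>\<^sub>2 \<and> \<theta> @ [a, b] \<in> sem V \<rho>}"
    unfolding sem.simps(2) par key append_assoc[symmetric] by blast
  also have "\<dots> = sem V (Cut A \<pi>\<^sub>1 (Exch (swap_blocks (length \<Delta> + length \<Theta>) 1) ?\<sigma>))"
    unfolding sem.simps(2)[of _ A] rot \<sigma> \<rho> append_assoc append.simps by blast
  finally show ?case .
next
  case (cut_plus1_with \<pi> \<Gamma> A \<rho>\<^sub>1 \<Delta> \<rho>\<^sub>2 B)
  have \<rho>: "a # xs \<in> sem V (Exch (swap_blocks (length \<Delta>) 1) \<rho>\<^sub>1) \<longleftrightarrow> xs @ [a] \<in> sem V \<rho>\<^sub>1" for a xs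
    unfolding sem.simps(3) using length_sem[OF cut_plus1_with(2), of _ V]
    by (intro image_swap_blocks_Cons) simp
  have swap_with: "a # xs \<in> sem V (Exch (swap_blocks (length \<Delta>) 1) (WithR \<rho>\<^sub>1 \<rho>\<^sub>2)) \<longleftrightarrow> xs @ [a] \<in> sem V (WithR \<rho>\<^sub>1 \<rho>\<^sub>2)"
    for a xs
    unfolding sem.simps(3)
    using length_sem[OF proves.with_rule[OF cut_plus1_with(2,3)], of _ V]
    by (intro image_swap_blocks_Cons) simp
  \<comment> \<open>\<open>In1\<close> and \<open>In2\<close> have disjoint ranges, so the cut meets
    only the matching branch of the with rule.\<close>
  show ?case unfolding sem.simps(2) \<rho> swap_with by auto
next
  case (cut_plus2_with \<pi> \<Gamma> B \<rho>\<^sub>1 \<Delta> A \<rho>\<^sub>2)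
  have \<rho>: "a # xs \<in> sem V (Exch (swap_blocks (length \<Delta>) 1) \<rho>\<^sub>2) \<longleftrightarrow> xs @ [a] \<in> sem V \<rho>\<^sub>2" for a xs
    unfolding sem.simps(3) using length_sem[OF cut_plus2_with(3), of _ V]
    by (intro image_swap_blocks_Cons) simp
  have swap_with: "a # xs \<in> sem V (Exch (swap_blocks (length \<Delta>) 1) (WithR \<rho>\<^sub>1 \<rho>\<^sub>2)) \<longleftrightarrow> xs @ [a] \<in> sem V (WithR \<rho>\<^sub>1 \<rho>\<^sub>2)"
    for a xs
    unfolding sem.simps(3)
    using length_sem[OF proves.with_rule[OF cut_plus2_with(2,3)], of _ V]
    by (intro image_swap_blocks_Cons) simp
  show ?case unfolding sem.simps(2) \<rho> swap_with by auto blast+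
next
  case (cut_bot \<pi> \<Gamma> A \<rho> \<Delta>)
  \<comment> \<open>The empty tuple is not in \<open>sem V \<rho>\<close>, as the conclusion of
    \<open>\<rho>\<close> contains the cut formula; so the final \<open>Star\<close> cannot be the
    head \<open>a\<close>.\<close>
  have bot: "a # xs \<in> sem V (BotR \<rho>) \<longleftrightarrow> (\<exists>\<delta>. xs = \<delta> @ [Star] \<and> a # \<delta> \<in> sem V \<rho>)" for a xs
    using length_sem[OF cut_bot(2), of "[]" V] by (auto simp: Cons_eq_append_conv)
  have "sem V (Cut A \<pi> (BotR \<rho>)) = {\<gamma> @ \<delta> @ [Star] | \<gamma> \<delta>. \<exists>a. \<gamma> @ [a] \<in> sem V \<pi> \<and> a # \<delta> \<in> sem V \<rho>}"
    unfolding sem.simps(2) bot by blast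
  also have "\<dots> = sem V (BotR (Cut A \<pi> \<rho>))"
    by auto blast+
  finally show ?case .
next
  case (cut_tensor1 \<pi> \<Gamma> A \<rho>\<^sub>1 \<Delta> B \<rho>\<^sub>2 \<Theta> C)
  have len: "Suc 0 < length \<delta>" if "\<delta> \<in> sem V \<rho>\<^sub>1" for \<delta>
    using length_sem[OF cut_tensor1(2) that] by simp
  have cut: "xs @ [b] \<in> sem V (Cut A \<pi> \<rho>\<^sub>1) \<longleftrightarrow>
     (\<exists>\<gamma> \<delta> a. xs = \<gamma> @ \<delta> \<and> \<gamma> @ [a] \<in> sem V \<pi> \<and> a # \<delta> @ [b] \<in> sem V \<rho>\<^sub>1)" for xs b
    using len by (intro sem_Cut_append) simp
  have tensor: "a # xs \<in> sem V (TensorR \<rho>\<^sub>1 \<rho>\<^sub>2) \<longleftrightarrow>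
      (\<exists>\<delta> \<theta> b c. xs = \<delta> @ \<theta> @ [Pair b c] \<and> a # \<delta> @ [b] \<in> sem V \<rho>\<^sub>1 \<and> \<theta> @ [c] \<in> sem V \<rho>\<^sub>2)" for a xs
    using len by (rule sem_TensorR_Cons)
  have "sem V (Cut A \<pi> (TensorR \<rho>\<^sub>1 \<rho>\<^sub>2)) = {\<gamma> @ \<delta> @ \<theta> @ [Pair b c] | \<gamma> \<delta> \<theta> b c.
      \<exists>a. \<gamma> @ [a] \<in> sem V \<pi> \<and> a # \<delta> @ [b] \<in> sem V \<rho>\<^sub>1 \<and> \<theta> @ [c] \<in> sem V \<rho>\<^sub>2}"
    unfolding sem.simps(2) tensor by blast
  also have "\<dots> = sem V (TensorR (Cut A \<pi> \<rho>\<^sub>1) \<rho>\<^sub>2)"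
    unfolding sem.simps(6) cut append_assoc[symmetric] by blast
  finally show ?case .
next
  case (cut_tensor2 \<pi> \<Gamma> A \<rho>\<^sub>1 \<Delta> B \<rho>\<^sub>2 \<Theta> C)
  let ?P = "\<lambda>\<delta> a \<theta> b c. \<delta> @ [b] \<in> sem V \<rho>\<^sub>1 \<and> a # \<theta> @ [c] \<in> sem V \<rho>\<^sub>2"
  have len1: "length \<delta> = length \<Delta>" if "\<delta> @ [b] \<in> sem V \<rho>\<^sub>1" for \<delta> b
    using length_sem[OF cut_tensor2(2) that] by simp
  have len2: "Suc 0 < length \<theta>" if "\<theta> \<in> sem V \<rho>\<^sub>2" for \<theta>
    using length_sem[OF cut_tensor2(3) that] by simp
  have len3: "length \<gamma> = length \<Gamma>" if "\<gamma> @ [a] \<in> sem V \<pi>" for \<gamma> a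
    using length_sem[OF cut_tensor2(1) that] by simp
  have cut: "xs @ [c] \<in> sem V (Cut A \<pi> \<rho>\<^sub>2) \<longleftrightarrow>
     (\<exists>\<gamma> \<theta> a. xs = \<gamma> @ \<theta> \<and> \<gamma> @ [a] \<in> sem V \<pi> \<and> a # \<theta> @ [c] \<in> sem V \<rho>\<^sub>2)" for xs c
    using len2 by (intro sem_Cut_append) simp
  \<comment> \<open>Writing a comprehension as a direct image lets \<open>image_image\<close> push
    the permutation into the map, after which only single tuples are compared.\<close>
  have image: "{F \<gamma> \<delta> \<theta> b c | \<gamma> \<delta> \<theta> b c. Q \<gamma> \<delta> \<theta> b c} =
      (\<lambda>(\<gamma>, \<delta>, \<theta>, b, c). F \<gamma> \<delta> \<theta> b c) ` {(\<gamma>, \<delta>, \<theta>, b, c). Q \<gamma> \<delta> \<theta> b c}" for F :: "_ \<Rightarrow> _ \<Rightarrow> _ \<Rightarrow> _ \<Rightarrow> _ \<Rightarrow> 'b point list" and Q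
    by (auto simp: image_iff; blast)
  have swap1: "permute_list (swap_blocks (length \<Delta>) (Suc 0)) (\<delta> @ a # zs) = a # \<delta> @ zs" if "\<delta> @ [b] \<in> sem V \<rho>\<^sub>1"
    for \<delta> a b zs
    using permute_list_swap_blocks[OF len1[OF that], of "[a]" "Suc 0" zs] by simp
  \<comment> \<open>The cut formula heads the context of the second premise, so in the tensor its
    point \<open>a\<close> stands right after \<open>\<delta>\<close>; displaying it there prepares
    the exchange that brings it to the front.\<close>
  have "sem V (TensorR \<rho>\<^sub>1 \<rho>\<^sub>2) = {\<delta> @ [a] @ \<theta> @ [Pair b c] | a \<delta> \<theta> b c. ?P \<delta> a \<theta> b c}"
  proof (intro equalityI subsetI)
    fix x assume "x \<in> sem V (TensorR \<rho>\<^sub>1 \<rho>\<^sub>2)"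
    then obtain \<delta> \<theta> b c where x: "x = \<delta> @ \<theta> @ [Pair b c]" "\<delta> @ [b] \<in> sem V \<rho>\<^sub>1" "\<theta> @ [c] \<in> sem V \<rho>\<^sub>2"
      by auto
    then obtain a \<theta>' where "\<theta> = a # \<theta>'" using len2[OF x(3)] by (cases \<theta>) auto
    with x show "x \<in> {\<delta> @ [a] @ \<theta> @ [Pair b c] | a \<delta> \<theta> b c. ?P \<delta> a \<theta> b c}" by auto
  next
    fix x assume "x \<in> {\<delta> @ [a] @ \<theta> @ [Pair b c] | a \<delta> \<theta> b c. ?P \<delta> a \<theta> b c}"
    then obtain \<delta> a \<theta> b c where "x = \<delta> @ (a # \<theta>) @ [Pair b c]" "\<delta> @ [b] \<in> sem V \<rho>\<^sub>1" "(a # \<theta>) @ [c] \<in> sem V \<rho>\<^sub>2"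
      by auto
    then show "x \<in> sem V (TensorR \<rho>\<^sub>1 \<rho>\<^sub>2)" unfolding sem.simps(6) by blast
  qed
  note tensor = this
  have "sem V (Exch (swap_blocks (length \<Delta>) 1) (TensorR \<rho>\<^sub>1 \<rho>\<^sub>2)) =
      {a # \<delta> @ \<theta> @ [Pair b c] | a \<delta> \<theta> b c. ?P \<delta> a \<theta> b c}"
    unfolding sem.simps(3) tensor unfolding image image_image
    by (intro image_cong refl) (auto simp: swap1)
  then have *: "a # xs \<in> sem V (Exch (swap_blocks (length \<Delta>) 1) (TensorR \<rho>\<^sub>1 \<rho>\<^sub>2)) \<longleftrightarrow>
      (\<exists>\<delta> \<theta> b c. xs = \<delta> @ \<theta> @ [Pair b c] \<and> ?P \<delta> a \<theta> b c)" for a xs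
    by auto
  have "sem V (Cut A \<pi> (Exch (swap_blocks (length \<Delta>) 1) (TensorR \<rho>\<^sub>1 \<rho>\<^sub>2))) =
      {\<gamma> @ \<delta> @ \<theta> @ [Pair b c] | \<gamma> \<delta> \<theta> b c. \<exists>a. \<gamma> @ [a] \<in> sem V \<pi> \<and> ?P \<delta> a \<theta> b c}"
    unfolding sem.simps(2) * by blast
  moreover have "sem V (TensorR \<rho>\<^sub>1 (Cut A \<pi> \<rho>\<^sub>2)) =
      {\<delta> @ \<gamma> @ \<theta> @ [Pair b c] | \<gamma> \<delta> \<theta> b c. \<exists>a. \<gamma> @ [a] \<in> sem V \<pi> \<and> ?P \<delta> a \<theta> b c}"
    unfolding sem.simps(6) cut by auto blast+
  note tensor_cut = this
  have "sem V (Exch (swap_blocks (length \<Delta>) (length \<Gamma>)) (TensorR \<rho>\<^sub>1 (Cut A \<pi> \<rho>\<^sub>2))) =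
      {\<gamma> @ \<delta> @ \<theta> @ [Pair b c] | \<gamma> \<delta> \<theta> b c. \<exists>a. \<gamma> @ [a] \<in> sem V \<pi> \<and> ?P \<delta> a \<theta> b c}"
    unfolding sem.simps(3) tensor_cut unfolding image image_image
    by (intro image_cong refl) (auto simp: permute_list_swap_blocks[OF len1 len3])
  ultimately show ?case by simp
next
  case (cut_par \<pi> \<Gamma> A \<rho> \<Delta> B C)
  have len: "Suc (Suc 0) < length \<delta>" if "\<delta> \<in> sem V \<rho>" for \<delta>
    using length_sem[OF cut_par(2) that] by simp
  have cut: "xs @ [b, c] \<in> sem V (Cut A \<pi> \<rho>) \<longleftrightarrow>
     (\<exists>\<gamma> \<delta> a. xs = \<gamma> @ \<delta> \<and> \<gamma> @ [a] \<in> sem V \<pi> \<and> a # \<delta> @ [b, c] \<in> sem V \<rho>)" for xs b c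
    using len by (intro sem_Cut_append) simp
  \<comment> \<open>\<open>len\<close> excludes an empty prefix: the pair would then be
    \<open>a\<close> itself and the premise would have a tuple of length two.\<close>
  have par: "a # xs \<in> sem V (ParR \<rho>) \<longleftrightarrow> (\<exists>\<delta> b c. xs = \<delta> @ [Pair b c] \<and> a # \<delta> @ [b, c] \<in> sem V \<rho>)"
    for a xs
    using len[of "[_, _]"] by (auto simp: Cons_eq_append_conv)
  have "sem V (Cut A \<pi> (ParR \<rho>)) = {\<gamma> @ \<delta> @ [Pair b c] | \<gamma> \<delta> b c.
      \<exists>a. \<gamma> @ [a] \<in> sem V \<pi> \<and> a # \<delta> @ [b, c] \<in> sem V \<rho>}"
    unfolding sem.simps(2) par by blast
  also have "\<dots> = sem V (ParR (Cut A \<pi> \<rho>))"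
    unfolding sem.simps(7) cut by auto blast+
  finally show ?case .
next
  case (cut_plus1 \<pi> \<Gamma> A \<rho> \<Delta> B C)
  show ?case unfolding sem.simps(2)[of _ _ _ "PlusR1 _ _"] sem.simps(8)
    using length_sem[OF cut_plus1(2), of _ V] by (intro cut_map_last) simp
next
  case (cut_plus2 \<pi> \<Gamma> A \<rho> \<Delta> C B)
  show ?case unfolding sem.simps(2)[of _ _ _ "PlusR2 _ _"] sem.simps(9)
    using length_sem[OF cut_plus2(2), of _ V] by (intro cut_map_last) simp
next
  case (cut_with \<pi> \<Gamma> A \<rho>\<^sub>1 \<Delta> B \<rho>\<^sub>2 C)
  have len: "Suc 0 < length \<delta>" if "\<delta> \<in> sem V \<rho>\<^sub>1 \<union> sem V \<rho>\<^sub>2" for \<delta>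
    using that length_sem[OF cut_with(2), of _ V] length_sem[OF cut_with(3), of _ V] by auto
  have "{\<gamma> @ \<delta> | \<gamma> \<delta>. \<exists>a. \<gamma> @ [a] \<in> sem V \<pi> \<and> a # \<delta> \<in> {\<delta> @ [In1 b] | \<delta> b. \<delta> @ [b] \<in> sem V \<rho>\<^sub>1}} =
      {\<gamma> @ [In1 b] | \<gamma> b. \<gamma> @ [b] \<in> sem V (Cut A \<pi> \<rho>\<^sub>1)}"
    by (intro cut_map_last len UnI1)
  moreover have "{\<gamma> @ \<delta> | \<gamma> \<delta>. \<exists>a. \<gamma> @ [a] \<in> sem V \<pi> \<and> a # \<delta> \<in> {\<delta> @ [In2 b] | \<delta> b. \<delta> @ [b] \<in> sem V \<rho>\<^sub>2}} =
      {\<gamma> @ [In2 b] | \<gamma> b. \<gamma> @ [b] \<in> sem V (Cut A \<pi> \<rho>\<^sub>2)}"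
    by (intro cut_map_last len UnI2)
  moreover have "{\<gamma> @ \<delta> | \<gamma> \<delta>. \<exists>a. \<gamma> @ [a] \<in> sem V \<pi> \<and> a # \<delta> \<in> X \<union> Y} =
      {\<gamma> @ \<delta> | \<gamma> \<delta>. \<exists>a. \<gamma> @ [a] \<in> sem V \<pi> \<and> a # \<delta> \<in> X} \<union>
      {\<gamma> @ \<delta> | \<gamma> \<delta>. \<exists>a. \<gamma> @ [a] \<in> sem V \<pi> \<and> a # \<delta> \<in> Y}" for X Y
    by blast
  ultimately show ?case
    by (simp only: sem.simps(10) sem.simps(2)[of _ _ _ "WithR _ _"])
next
  case (cut_top \<pi> \<Gamma> A \<Delta>)
  then show ?case by simp
next
  case (cut_cut \<pi> \<Gamma> A \<rho>\<^sub>1 \<Delta> B \<rho>\<^sub>2 \<Theta>)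
  have len: "Suc 0 < length \<delta>" if "\<delta> \<in> sem V \<rho>\<^sub>1" for \<delta>
    using length_sem[OF cut_cut(2) that] by simp
  have cut: "xs @ [b] \<in> sem V (Cut A \<pi> \<rho>\<^sub>1) \<longleftrightarrow>
     (\<exists>\<gamma> \<delta> a. xs = \<gamma> @ \<delta> \<and> \<gamma> @ [a] \<in> sem V \<pi> \<and> a # \<delta> @ [b] \<in> sem V \<rho>\<^sub>1)" for xs b
    using len by (intro sem_Cut_append) simp
  have cut2: "a # xs \<in> sem V (Cut B \<rho>\<^sub>1 \<rho>\<^sub>2) \<longleftrightarrow>
      (\<exists>\<delta> \<theta> b. xs = \<delta> @ \<theta> \<and> a # \<delta> @ [b] \<in> sem V \<rho>\<^sub>1 \<and> b # \<theta> \<in> sem V \<rho>\<^sub>2)" for a xs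
  proof -
    have "\<exists>\<delta> \<theta> b. xs = \<delta> @ \<theta> \<and> a # \<delta> @ [b] \<in> sem V \<rho>\<^sub>1 \<and> b # \<theta> \<in> sem V \<rho>\<^sub>2"
      if ax: "a # xs \<in> sem V (Cut B \<rho>\<^sub>1 \<rho>\<^sub>2)"
    proof -
      obtain \<delta> \<theta> b where *: "a # xs = \<delta> @ \<theta>" "\<delta> @ [b] \<in> sem V \<rho>\<^sub>1" "b # \<theta> \<in> sem V \<rho>\<^sub>2"
        using ax by auto
      then obtain \<delta>' where "\<delta> = a # \<delta>'" using len[OF *(2)] by (cases \<delta>) auto
      with * show ?thesis by auto
    qed
    moreover have "a # \<delta> @ \<theta> \<in> sem V (Cut B \<rho>\<^sub>1 \<rho>\<^sub>2)"
      if "(a # \<delta>) @ [b] \<in> sem V \<rho>\<^sub>1" "b # \<theta> \<in> sem V \<rho>\<^sub>2" for \<delta> \<theta> b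
      unfolding append_Cons[symmetric] sem.simps(2) using that by blast
    ultimately show ?thesis by auto
  qed
  have "sem V (Cut A \<pi> (Cut B \<rho>\<^sub>1 \<rho>\<^sub>2)) = {\<gamma> @ \<delta> @ \<theta> | \<gamma> \<delta> \<theta>.
      \<exists>a b. \<gamma> @ [a] \<in> sem V \<pi> \<and> a # \<delta> @ [b] \<in> sem V \<rho>\<^sub>1 \<and> b # \<theta> \<in> sem V \<rho>\<^sub>2}"
    unfolding sem.simps(2)[of _ A] cut2 by blast
  also have "\<dots> = sem V (Cut B (Cut A \<pi> \<rho>\<^sub>1) \<rho>\<^sub>2)"
    unfolding sem.simps(2)[of _ B] cut append_assoc[symmetric] by blast
  finally show ?case .
qed

section \<open>Axiom expansion and closure under reduction\<close>

lemma permute_list_swap_blocks_1_1: "permute_list (swap_blocks 1 1) [a, b] = [b, a]"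
  using permute_list_swap_blocks[of "[a]" 1 "[b]" 1 "[]"] by simp

lemma image_swap_blocks_1_1:
  "permute_list (swap_blocks 1 1) ` {[f a, g a] | a. P a} = {[g a, f a] | a. P a}"
proof -
  have "{[f a, g a] | a. P a} = (\<lambda>a. [f a, g a]) ` {a. P a}" "{[g a, f a] | a. P a} = (\<lambda>a. [g a, f a]) ` {a. P a}"
    by auto
  then show ?thesis by (simp only: image_image permute_list_swap_blocks_1_1)
qed

text \<open>The identity relation on a composite web is assembled from those on its parts:
  componentwise on pairs for \<open>Tensor\<close>, as a tagged union for \<open>With\<close>. It is
  empty for \<open>Top\<close> and has the single point \<open>Star\<close> to relate for
  \<open>One\<close>.\<close>

lemma sem_eta_rule: "eta_rule \<pi> \<pi>' \<Longrightarrow> sem V \<pi> = sem V \<pi>'"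
proof (induction rule: eta_rule.induct)
  case eta_one
  show ?case by (auto simp: permute_list_swap_blocks_1_1[unfolded One_nat_def])
next
  case eta_top
  show ?case by simp
next
  case (eta_tensor A B)
  have rot: "permute_list (swap_blocks 2 1) [a, b, c] = [c, a, b]" for a b c :: "'b point"
    using permute_list_swap_blocks[of "[a, b]" 2 "[c]" 1 "[]"] by simp
  have tensor: "sem V (TensorR (Ax A) (Ax B)) = (\<lambda>(a, b). [a, b, Pair a b]) ` (pts V A \<times> pts V B)"
    by (auto simp: append_eq_Cons_conv image_iff)
  have "sem V (Exch (swap_blocks 2 1) (TensorR (Ax A) (Ax B))) = (\<lambda>(a, b). [Pair a b, a, b]) ` (pts V A \<times> pts V B)"
    unfolding sem.simps(3) tensor image_image by (intro image_cong refl) (simp only: rot split_def)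
  then have "sem V (ParR (Exch (swap_blocks 2 1) (TensorR (Ax A) (Ax B)))) =
      {[c, c] | c. c \<in> pts V (Tensor A B)}"
    unfolding sem.simps(7) by (auto simp: append_eq_Cons_conv)
  then show ?case
    unfolding sem.simps(1) sem.simps(3)[of _ _ "ParR _"]
    by (simp only: image_swap_blocks_1_1[of "\<lambda>a. a" "\<lambda>a. a"])
next
  case (eta_with A B)
  have last: "{\<gamma> @ [h b] | \<gamma> b. \<gamma> @ [b] \<in> {[f a, a] | a. P a}} = {[f a, h a] | a. P a}"
    for f h :: "'b point \<Rightarrow> 'b point" and P
    by (auto simp: append_eq_Cons_conv; blast)
  have "sem V (Exch (swap_blocks 1 1) (PlusR1 (dual B) (Exch (swap_blocks 1 1) (Ax A)))) =
      {[In1 a, a] | a. a \<in> pts V A}"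
    by (simp only: sem.simps image_swap_blocks_1_1[of "\<lambda>a. a" "\<lambda>a. a"] last[of In1 "\<lambda>a. a"]
      image_swap_blocks_1_1[of "\<lambda>a. a" In1])
  moreover have "sem V (Exch (swap_blocks 1 1) (PlusR2 (dual A) (Exch (swap_blocks 1 1) (Ax B)))) =
      {[In2 a, a] | a. a \<in> pts V B}"
    by (simp only: sem.simps image_swap_blocks_1_1[of "\<lambda>a. a" "\<lambda>a. a"] last[of In2 "\<lambda>a. a"]
      image_swap_blocks_1_1[of "\<lambda>a. a" In2])
  ultimately show ?case
    by (simp only: sem.simps(1) sem.simps(10) last) auto
qed

lemma sem_step: "step \<pi> \<pi>' \<Longrightarrow> sem V \<pi> = sem V \<pi>'"
proof (induction rule: step.induct)
  case (exch_rule \<pi> \<pi>')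
  then show ?case by (rule sem_exch_rule)
next
  case (cut_rule \<pi> \<pi>')
  then show ?case by (rule sem_cut_rule)
next
  case (eta_rule \<pi> \<pi>')
  then show ?case by (rule sem_eta_rule)
qed simp_all

lemma sem_cut_elim_equiv: "cut_elim_equiv \<pi> \<pi>' \<Longrightarrow> sem V \<pi> = sem V \<pi>'"
  unfolding cut_elim_equiv_def
  by (induction rule: equivclp_induct) (auto dest: sem_step)

section \<open>The bijection of an isomorphism of types\<close>

text \<open>The equation \<open>[b] = \<gamma> @ \<delta>\<close> has two solutions; the one-formula
  conclusion of \<open>\<rho>\<close> forces \<open>\<gamma>\<close> to be empty, so the cut is a
  direct image.\<close>

lemma sem_Cut_singleton: "[b] \<in> sem V (Cut A \<rho> \<pi>) \<longleftrightarrow> (\<exists>a. [a] \<in> sem V \<rho> \<and> [a, b] \<in> sem V \<pi>)"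
  if "proves \<rho> [A]"
proof
  assume "[b] \<in> sem V (Cut A \<rho> \<pi>)"
  then obtain \<gamma> \<delta> a where *: "[b] = \<gamma> @ \<delta>" "\<gamma> @ [a] \<in> sem V \<rho>" "a # \<delta> \<in> sem V \<pi>" by auto
  then have "\<gamma> = []" using length_sem[OF that *(2)] by simp
  with * show "\<exists>a. [a] \<in> sem V \<rho> \<and> [a, b] \<in> sem V \<pi>" by auto
next
  assume "\<exists>a. [a] \<in> sem V \<rho> \<and> [a, b] \<in> sem V \<pi>"
  then obtain a where "[] @ [a] \<in> sem V \<rho>" "a # [b] \<in> sem V \<pi>" by auto
  then have "[] @ [b] \<in> sem V (Cut A \<rho> \<pi>)" unfolding sem.simps by blast
  then show "[b] \<in> sem V (Cut A \<rho> \<pi>)" by simp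
qed

lemma sem_Cut_pair: "[a, c] \<in> sem V (Cut B \<pi> \<rho>) \<longleftrightarrow> (\<exists>b. [a, b] \<in> sem V \<pi> \<and> [b, c] \<in> sem V \<rho>)"
  if \<pi>: "proves \<pi> [A, B]"
proof
  assume "[a, c] \<in> sem V (Cut B \<pi> \<rho>)"
  then obtain \<gamma> \<delta> b where *: "[a, c] = \<gamma> @ \<delta>" "\<gamma> @ [b] \<in> sem V \<pi>" "b # \<delta> \<in> sem V \<rho>" by auto
  then obtain x where "\<gamma> = [x]" using length_sem[OF \<pi> *(2)] by (auto simp: length_Suc_conv)
  with * show "\<exists>b. [a, b] \<in> sem V \<pi> \<and> [b, c] \<in> sem V \<rho>" by auto
next
  assume "\<exists>b. [a, b] \<in> sem V \<pi> \<and> [b, c] \<in> sem V \<rho>"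
  then obtain b where "[a] @ [b] \<in> sem V \<pi>" "b # [c] \<in> sem V \<rho>" by auto
  then have "[a] @ [c] \<in> sem V (Cut B \<pi> \<rho>)" unfolding sem.simps by blast
  then show "[a, c] \<in> sem V (Cut B \<pi> \<rho>)" by simp
qed

text \<open>Two relations that compose to the identity in both orders are graphs of bijections,
  converse to each other. The relation of \<open>\<pi>'\<close> is therefore described with the same
  \<open>f\<close>, so that it can serve for the inverse.\<close>

lemma isomorphic_types_bij:
  assumes "isomorphic_types A B"
  obtains f \<pi> \<pi>' where "bij_betw f (pts V A) (pts V B)" "proves \<pi> [dual A, B]" "proves \<pi>' [dual B, A]"
    "\<And>a b. [a, b] \<in> sem V \<pi> \<longleftrightarrow> a \<in> pts V A \<and> b = f a"
    "\<And>a b. [b, a] \<in> sem V \<pi>' \<longleftrightarrow> a \<in> pts V A \<and> b = f a"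
proof -
  obtain \<pi> \<pi>' where \<pi>: "proves \<pi> [dual A, B]" and \<pi>': "proves \<pi>' [dual B, A]"
    and "cut_elim_equiv (Cut B \<pi> \<pi>') (Ax A)" "cut_elim_equiv (Cut A \<pi>' \<pi>) (Ax B)"
    using assms unfolding isomorphic_types_def by blast
  then have semA: "sem V (Cut B \<pi> \<pi>') = sem V (Ax A)" and semB: "sem V (Cut A \<pi>' \<pi>) = sem V (Ax B)"
    by (blast dest: sem_cut_elim_equiv)+
  have A: "(\<exists>b. [a, b] \<in> sem V \<pi> \<and> [b, a'] \<in> sem V \<pi>') \<longleftrightarrow> a = a' \<and> a \<in> pts V A" for a a'
    unfolding sem_Cut_pair[OF \<pi>, symmetric] semA by auto
  have B: "(\<exists>a. [b, a] \<in> sem V \<pi>' \<and> [a, b'] \<in> sem V \<pi>) \<longleftrightarrow> b = b' \<and> b \<in> pts V B" for b b'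
    unfolding sem_Cut_pair[OF \<pi>', symmetric] semB by auto
  have typed: "a \<in> pts V A \<and> b \<in> pts V B" if "[a, b] \<in> sem V \<pi>" for a b
    using sem_typed[OF \<pi> that] by simp
  have typed': "a \<in> pts V A \<and> b \<in> pts V B" if "[b, a] \<in> sem V \<pi>'" for a b
    using sem_typed[OF \<pi>' that] by simp
  \<comment> \<open>The chosen \<open>b\<close> has to be related to \<open>a\<close> in both
    directions: if also \<open>[a, b'] \<in> sem V \<pi>\<close>, then \<open>b'\<close> is reached
    from \<open>f a\<close> through \<open>a\<close>, and \<open>B\<close> gives
    \<open>b' = f a\<close>.\<close>
  define f where "f a = (SOME b. [a, b] \<in> sem V \<pi> \<and> [b, a] \<in> sem V \<pi>')" for a
  have f: "[a, f a] \<in> sem V \<pi>" "[f a, a] \<in> sem V \<pi>'" if "a \<in> pts V A" for a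
  proof -
    have "\<exists>b. [a, b] \<in> sem V \<pi> \<and> [b, a] \<in> sem V \<pi>'" using A that by blast
    from someI_ex[OF this] show "[a, f a] \<in> sem V \<pi>" "[f a, a] \<in> sem V \<pi>'" by (simp_all add: f_def)
  qed
  have R: "[a, b] \<in> sem V \<pi> \<longleftrightarrow> a \<in> pts V A \<and> b = f a" for a b
    using B[of "f a" b] f[of a] typed[of a b] by blast
  have S: "[b, a] \<in> sem V \<pi>' \<longleftrightarrow> a \<in> pts V A \<and> b = f a" for a b
  proof
    assume ba: "[b, a] \<in> sem V \<pi>'"
    then have "a \<in> pts V A" using typed' by blast
    moreover from this have "b = f a" using B[of b "f a"] f ba by blast
    ultimately show "a \<in> pts V A \<and> b = f a" ..
  qed (use f in blast)
  have "inj_on f (pts V A)"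
  proof (rule inj_onI)
    fix x y assume "x \<in> pts V A" "y \<in> pts V A" "f x = f y"
    then show "x = y" using A[of x y] f by metis
  qed
  moreover have "f ` pts V A = pts V B"
  proof (intro equalityI subsetI)
    fix b assume "b \<in> f ` pts V A"
    then show "b \<in> pts V B" using f typed by blast
  next
    fix b assume "b \<in> pts V B"
    then obtain a where "[a, b] \<in> sem V \<pi>" using B[of b b] by blast
    then show "b \<in> f ` pts V A" using R by blast
  qed
  ultimately have "bij_betw f (pts V A) (pts V B)" by (simp add: bij_betw_def)
  from this \<pi> \<pi>' R S show ?thesis by (rule that)
qed

lemma image_simplices_formula_complex:
  assumes "proves \<pi> [dual A, B]" "\<And>a. a \<in> pts V A \<Longrightarrow> [a, f a] \<in> sem V \<pi>"
    "x \<in> simplices (formula_complex V A)"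
  shows "f ` x \<in> simplices (formula_complex V B)"
proof -
  obtain \<rho> where \<rho>: "finite x" "x \<noteq> {}" "proves \<rho> [A]" "\<And>a. a \<in> x \<Longrightarrow> [a] \<in> sem V \<rho>"
    using assms(3) by (auto simp: formula_complex_def)
  have "proves (Cut A \<rho> \<pi>) ([] @ [B])" using \<rho>(3) assms(1) by (intro proves.cut) simp_all
  moreover have "[f a] \<in> sem V (Cut A \<rho> \<pi>)" if "a \<in> x" for a
  proof -
    have "a \<in> pts V A" using sem_typed[OF \<rho>(3) \<rho>(4)[OF that]] by simp
    then show ?thesis using sem_Cut_singleton[OF \<rho>(3)] \<rho>(4)[OF that] assms(2) by blast
  qed
  ultimately show ?thesis using \<rho>(1,2) by (auto simp: formula_complex_def)
qed

lemma simplices_formula_complex_image: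
  assumes "isomorphic_types A B"
  obtains f where "inj_on f (pts V A)"
    "simplices (formula_complex V B) = image f ` simplices (formula_complex V A)"
proof -
  obtain f \<pi> \<pi>' where bij: "bij_betw f (pts V A) (pts V B)" and \<pi>: "proves \<pi> [dual A, B]" and \<pi>': "proves \<pi>' [dual B, A]"
    and R: "\<And>a b. [a, b] \<in> sem V \<pi> \<longleftrightarrow> a \<in> pts V A \<and> b = f a"
    and S: "\<And>a b. [b, a] \<in> sem V \<pi>' \<longleftrightarrow> a \<in> pts V A \<and> b = f a"
    using isomorphic_types_bij[OF assms] by blast
  let ?g = "inv_into (pts V A) f"
  have "y \<in> image f ` simplices (formula_complex V A)" if y: "y \<in> simplices (formula_complex V B)"
    for y
  proof -
    \<comment> \<open>The preimage of \<open>y\<close> is its image under the inverse bijection, a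
      simplex because \<open>\<pi>'\<close> denotes the graph of that inverse.\<close>
    have "?g ` y \<in> simplices (formula_complex V A)"
    proof (rule image_simplices_formula_complex[OF \<pi>' _ y])
      fix b assume "b \<in> pts V B"
      then show "[b, ?g b] \<in> sem V \<pi>'"
        using bij by (simp add: S bij_betw_def inv_into_into f_inv_into_f)
    qed
    moreover have "y \<subseteq> pts V B"
      using y sem_typed[of _ "[B]" "[_]" V] by (fastforce simp: formula_complex_def)
    then have "f ` ?g ` y = y"
      using bij by (force simp: bij_betw_def f_inv_into_f image_image)
    ultimately show ?thesis by (metis imageI)
  qed
  moreover have "f ` x \<in> simplices (formula_complex V B)" if "x \<in> simplices (formula_complex V A)"
    for x
    using that by (intro image_simplices_formula_complex[OF \<pi>]) (simp_all add: R)
  ultimately have "simplices (formula_complex V B) = image f ` simplices (formula_complex V A)"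
    by blast
  with bij_betw_imp_inj_on[OF bij] show ?thesis by (rule that)
qed

section \<open>Isomorphisms of complexes and homology\<close>

lemma simplices_union_complex_image:
  assumes "inj_on f W" "simplices X \<subseteq> Pow W" "simplices Y = image f ` simplices X"
  shows "simplices (union_complex Y) = image (image f) ` simplices (union_complex X)"
proof (intro equalityI subsetI)
  fix U' assume "U' \<in> simplices (union_complex Y)"
  then have U': "finite U'" "U' \<noteq> {}" "U' \<subseteq> image f ` simplices X" "\<Union>U' \<in> image f ` simplices X"
    by (simp_all add: union_complex_def assms(3))
  then obtain U where U: "U \<subseteq> simplices X" "finite U" "U' = image f ` U"
    by (meson finite_subset_image)
  obtain x where x: "x \<in> simplices X" "\<Union>U' = f ` x" using U'(4) by blast
  have "f ` \<Union>U = f ` x" using x(2) U(3) by (simp add: image_Union)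
  \<comment> \<open>\<open>x\<close> is just some simplex with the right image; injectivity on
    \<open>W\<close> identifies it with the union of the lifted family, which makes that family a
    simplex.\<close>
  then have "\<Union>U = x"
    using assms(1,2) U(1) x(1) by (subst (asm) inj_on_image_eq_iff[of f W]) blast+
  then have "U \<in> simplices (union_complex X)"
    using U U'(2) x(1) by (auto simp: union_complex_def)
  then show "U' \<in> image (image f) ` simplices (union_complex X)" using U(3) by blast
next
  fix U' assume "U' \<in> image (image f) ` simplices (union_complex X)"
  then obtain U where U: "finite U" "U \<noteq> {}" "U \<subseteq> simplices X" "\<Union>U \<in> simplices X" "U' = image f ` U"
    by (auto simp: union_complex_def)
  then have "\<Union>U' = f ` \<Union>U" by auto
  then show "U' \<in> simplices (union_complex Y)"
    using U by (auto simp: union_complex_def assms(3))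
qed

section \<open>Maps induced on free chains and on quotients\<close>

definition frag_map :: "('v \<Rightarrow> 'w) \<Rightarrow> ('v list \<Rightarrow>\<^sub>0 int) \<Rightarrow> ('w list \<Rightarrow>\<^sub>0 int)" where
  "frag_map f = frag_extend (frag_of \<circ> map f)"

lemma frag_map_add: "frag_map f (x + y) = frag_map f x + frag_map f y"
  by (simp add: frag_map_def frag_extend_add)

text \<open>Deleting the \<open>i\<close>-th entry of a list commutes with \<open>map f\<close>.
  Both maps act on chains of arbitrary lists, hence the induction over \<open>UNIV\<close>.\<close>

lemma frag_map_free_boundary: "frag_map f (free_boundary x) = free_boundary (frag_map f x)"
proof (rule frag_induction[of x UNIV])
  fix vs
  show "frag_map f (free_boundary (frag_of vs)) = free_boundary (frag_map f (frag_of vs))"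
    by (simp add: frag_map_def free_boundary_def frag_extend_sum frag_extend_cmul take_map drop_map)
qed (simp_all add: frag_map_def free_boundary_def frag_extend_diff)

lemma image_set_mult:
  assumes "\<And>x y. h (x \<otimes>\<^bsub>G\<^esub> y) = h x \<otimes>\<^bsub>H\<^esub> h y"
  shows "h ` (M <#>\<^bsub>G\<^esub> N) = (h ` M) <#>\<^bsub>H\<^esub> (h ` N)"
  by (simp add: set_mult_def image_UN assms)

lemma image_carrier_Mod:
  assumes "\<And>x y. h (x \<otimes>\<^bsub>G\<^esub> y) = h x \<otimes>\<^bsub>H\<^esub> h y" "h ` carrier G = carrier H"
  shows "image h ` carrier (G Mod N) = carrier (H Mod (h ` N))"
proof -
  have "h ` (N #>\<^bsub>G\<^esub> x) = h ` N #>\<^bsub>H\<^esub> h x" for x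
    by (simp add: r_coset_def image_UN assms(1))
  then show ?thesis
    by (simp add: FactGroup_def RCOSETS_def image_UN flip: assms(2))
qed

text \<open>Injectivity of \<open>h\<close> on \<open>C\<close> yields injectivity of its direct
  image on \<open>Pow C\<close>, so cosets have to be placed there. \<open>C\<close> bounds both the
  carrier and \<open>N\<close>.\<close>

lemma carrier_Mod_subset_Pow:
  assumes "\<And>x y. x \<in> C \<Longrightarrow> y \<in> C \<Longrightarrow> x \<otimes>\<^bsub>G\<^esub> y \<in> C" "carrier G \<subseteq> C" "N \<subseteq> C"
  shows "carrier (G Mod N) \<subseteq> Pow C"
  using assms by (auto simp: FactGroup_def RCOSETS_def r_coset_def subset_iff)

text \<open>
  No subgroup or group axioms are needed: applied to \<open>+\<close> on chains, to products of cosets and to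
  products of sets of cosets, the homomorphism property holds without carrier restrictions, so that
  it never has to be checked that the quotients in the definition of homology are well defined.
\<close>

lemma Mod_iso_image:
  assumes "\<And>x y. h (x \<otimes>\<^bsub>G\<^esub> y) = h x \<otimes>\<^bsub>H\<^esub> h y" "h ` carrier G = carrier H"
    and "\<And>x y. x \<in> C \<Longrightarrow> y \<in> C \<Longrightarrow> x \<otimes>\<^bsub>G\<^esub> y \<in> C" "carrier G \<subseteq> C" "N \<subseteq> C"
    and "inj_on h C"
  shows "image h \<in> iso (G Mod N) (H Mod (h ` N))"
proof -
  have "inj_on (image h) (carrier (G Mod N))"
    by (rule inj_on_subset[OF inj_on_image_Pow[OF assms(6)] carrier_Mod_subset_Pow[OF assms(3-5)]])
  then show ?thesis
    using image_carrier_Mod[OF assms(1,2)]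
    by (auto simp: iso_def hom_def bij_betw_def image_set_mult[of h, OF assms(1)])
qed

lemma one_chains: "\<one>\<^bsub>chains X k\<^esub> = orientation_rels X k"
  by (simp add: chains_def FactGroup_def)

lemma free_chains_mult_closed:
  assumes "x \<in> carrier (free_chains X k)" "y \<in> carrier (free_chains X k)"
  shows "x \<otimes>\<^bsub>free_chains X k\<^esub> y \<in> carrier (free_chains X k)"
  using group.is_monoid[OF group_free_Abelian_group] assms
  unfolding free_chains_def by (rule monoid.m_closed)

section \<open>Transport of chains, cycles and boundaries along a bijection of simplices\<close>

locale complex_iso =
  fixes X :: "'v complex" and Y :: "'w complex" and f :: "'v \<Rightarrow> 'w"
  assumes down: "\<And>x y. x \<in> simplices X \<Longrightarrow> y \<subseteq> x \<Longrightarrow> y \<noteq> {} \<Longrightarrow> y \<in> simplices X"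
    and inj: "inj_on f (\<Union>(simplices X))"
    and simplices: "simplices Y = image f ` simplices X"
begin

lemma ordered_simplices_image:
  "ordered_simplices Y k = map f ` ordered_simplices X k"
proof (intro equalityI subsetI)
  fix ws assume "ws \<in> ordered_simplices Y k"
  then obtain x where ws: "length ws = Suc k" "distinct ws" "set ws = f ` x" "x \<in> simplices X"
    by (auto simp: ordered_simplices_def simplices)
  \<comment> \<open>The inverse is taken relative to the single simplex \<open>x\<close>, on which
    \<open>f\<close> is injective, so the lifted list has exactly the vertices of
    \<open>x\<close>.\<close>
  define vs where "vs = map (inv_into x f) ws"
  have ix: "inj_on f x" using inj ws(4) by (meson Union_upper inj_on_subset)
  have "map f vs = ws" using ws(3) by (auto simp: vs_def f_inv_into_f intro!: map_idI)
  moreover have "set vs = x" using ws(3) ix by (force simp: vs_def)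
  moreover have "distinct vs" using ws(2,3) by (simp add: vs_def distinct_map inj_on_inv_into)
  ultimately show "ws \<in> map f ` ordered_simplices X k"
    using ws by (intro image_eqI[of _ _ vs]) (auto simp: ordered_simplices_def vs_def)
next
  fix ws assume "ws \<in> map f ` ordered_simplices X k"
  moreover have "inj_on f x" if "x \<in> simplices X" for x
    using inj that by (meson Union_upper inj_on_subset)
  ultimately show "ws \<in> ordered_simplices Y k"
    by (auto simp: ordered_simplices_def simplices distinct_map)
qed

text \<open>The two lists may come from different simplices, which is why \<open>inj\<close> speaks
  of the union of all simplices and not of each one separately.\<close>

lemma inj_map: "inj_on (map f) (ordered_simplices X k)"
proof (rule inj_onI)
  fix us vs assume "us \<in> ordered_simplices X k" "vs \<in> ordered_simplices X k" "map f us = map f vs"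
  then show "us = vs"
    using inj_on_subset[OF inj, of "set us \<union> set vs"]
    by (auto simp: ordered_simplices_def dest: map_inj_on)
qed

text \<open>Linear extension respects composition and depends only on the values at the keys, so an
  inverse on the generators extends to an inverse on chains.\<close>

lemma frag_map_inverse:
  assumes "x \<in> carrier (free_chains X k)"
  shows "frag_extend (frag_of \<circ> inv_into (ordered_simplices X k) (map f)) (frag_map f x) = x"
proof -
  have "frag_extend (frag_of \<circ> inv_into (ordered_simplices X k) (map f)) (frag_map f x)
    = frag_extend (frag_of \<circ> inv_into (ordered_simplices X k) (map f) \<circ> map f) x"
    by (simp add: frag_map_def frag_extend_compose)
  also have "\<dots> = frag_extend frag_of x"
    using assms inj_map by (intro frag_extend_eq) (auto simp: free_chains_def)
  finally show ?thesis by (simp flip: frag_expansion)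
qed

lemma inj_frag_map: "inj_on (frag_map f) (carrier (free_chains X k))"
  by (rule inj_on_inverseI) (rule frag_map_inverse)

lemma frag_map_carrier: "frag_map f ` carrier (free_chains X k) = carrier (free_chains Y k)"
proof (intro equalityI subsetI)
  fix y assume "y \<in> frag_map f ` carrier (free_chains X k)"
  then show "y \<in> carrier (free_chains Y k)"
    using keys_frag_extend[of "frag_of \<circ> map f"]
    by (fastforce simp: free_chains_def frag_map_def ordered_simplices_image)
next
  let ?g = "inv_into (ordered_simplices X k) (map f)"
  fix y assume y: "y \<in> carrier (free_chains Y k)"
  have "frag_map f (frag_extend (frag_of \<circ> ?g) y) = frag_extend (frag_of \<circ> map f \<circ> ?g) y"
    by (simp add: frag_map_def frag_extend_compose)
  also have "\<dots> = frag_extend frag_of y"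
    using y
    by (intro frag_extend_eq) (auto simp: free_chains_def ordered_simplices_image f_inv_into_f)
  finally have "frag_map f (frag_extend (frag_of \<circ> ?g) y) = y" by (simp flip: frag_expansion)
  moreover have "?g vs \<in> ordered_simplices X k" if "vs \<in> Poly_Mapping.keys y" for vs
    using y that by (intro inv_into_into) (auto simp: free_chains_def ordered_simplices_image)
  then have "frag_extend (frag_of \<circ> ?g) y \<in> carrier (free_chains X k)"
    by (auto simp: free_chains_def dest!: subsetD[OF keys_frag_extend])
  ultimately show "y \<in> frag_map f ` carrier (free_chains X k)" by (metis imageI)
qed

lemma frag_map_mult: "frag_map f (x \<otimes>\<^bsub>free_chains X k\<^esub> y) = frag_map f x \<otimes>\<^bsub>free_chains Y k\<^esub> frag_map f y"
  by (simp add: free_chains_def frag_map_add)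

lemma group_hom_frag_map: "group_hom (free_chains X k) (free_chains Y k) (frag_map f)"
proof -
  have "frag_map f \<in> hom (free_chains X k) (free_chains Y k)"
    by (rule homI) (use frag_map_carrier[of k] in \<open>blast, simp add: frag_map_mult\<close>)
  then show ?thesis
    by (simp add: group_hom_def group_hom_axioms_def free_chains_def)
qed

lemma permute_ordered_simplices:
  assumes "vs \<in> ordered_simplices X k" "p permutes {..<Suc k}"
  shows "permute_list p vs \<in> ordered_simplices X k"
  using assms by (auto simp: ordered_simplices_def)

lemma orientation_generators_subset:
  "{frag_of (permute_list p vs) - frag_cmul (sign p) (frag_of vs) | p vs.
    vs \<in> ordered_simplices X k \<and> p permutes {..<Suc k}} \<subseteq> carrier (free_chains X k)"
  using permute_ordered_simplices
  by (auto simp: free_chains_def dest!: subsetD[OF keys_diff] subsetD[OF keys_cmul])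

lemma orientation_rels_subset: "orientation_rels X k \<subseteq> carrier (free_chains X k)"
  unfolding orientation_rels_def
  by (rule group.generate_incl[OF _ orientation_generators_subset]) (simp add: free_chains_def)

text \<open>Permuting positions commutes with \<open>map f\<close>, so generators correspond to
  generators with the same sign, and a homomorphism maps a generated subgroup onto the one generated
  by the image.\<close>

lemma frag_map_orientation_rels: "frag_map f ` orientation_rels X k = orientation_rels Y k"
proof -
  let ?S = "{frag_of (permute_list p vs) - frag_cmul (sign p) (frag_of vs) | p vs.
    vs \<in> ordered_simplices X k \<and> p permutes {..<Suc k}}"
  from group_hom.generate_img[OF group_hom_frag_map orientation_generators_subset]
  have "frag_map f ` orientation_rels X k = generate (free_chains Y k) (frag_map f ` ?S)"
    by (simp add: orientation_rels_def)
  also have "frag_map f ` ?S =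
     {frag_of (permute_list p vs) - frag_cmul (sign p) (frag_of vs) | p vs.
        vs \<in> ordered_simplices Y k \<and> p permutes {..<Suc k}}" (is "_ = ?T")
  proof -
    have "frag_map f (frag_of (permute_list p vs) - frag_cmul (sign p) (frag_of vs)) =
      frag_of (permute_list p (map f vs)) - frag_cmul (sign p) (frag_of (map f vs))"
      if "vs \<in> ordered_simplices X k" "p permutes {..<Suc k}" for p vs
      using that
      by (auto simp: frag_map_def frag_extend_diff frag_extend_cmul permute_list_map ordered_simplices_def)
    then show ?thesis unfolding ordered_simplices_image by (auto 4 4 simp: image_iff)
  qed
  finally show ?thesis by (simp add: orientation_rels_def)
qed

lemma image_chains_carrier: "image (frag_map f) ` carrier (chains X k) = carrier (chains Y k)"
  unfolding chains_def frag_map_orientation_rels[symmetric]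
  by (rule image_carrier_Mod[OF frag_map_mult frag_map_carrier])

lemma image_chains_mult: "frag_map f ` (c \<otimes>\<^bsub>chains X k\<^esub> d) = (frag_map f ` c) \<otimes>\<^bsub>chains Y k\<^esub> (frag_map f ` d)"
  by (simp add: chains_def image_set_mult[of "frag_map f", OF frag_map_mult])

lemma chains_subset: "carrier (chains X k) \<subseteq> Pow (carrier (free_chains X k))"
  unfolding chains_def using orientation_rels_subset
  by (intro carrier_Mod_subset_Pow free_chains_mult_closed order_refl)

text \<open>The factors are arbitrary sets of chains, not just cosets, because
  \<open>Mod_iso_image\<close> is applied with all of \<open>Pow (carrier (free_chains X k))\<close>
  as \<open>C\<close>.\<close>

lemma chains_mult_closed:
  assumes "c \<subseteq> carrier (free_chains X k)" "d \<subseteq> carrier (free_chains X k)"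
  shows "c \<otimes>\<^bsub>chains X k\<^esub> d \<subseteq> carrier (free_chains X k)"
proof
  fix z assume "z \<in> c \<otimes>\<^bsub>chains X k\<^esub> d"
  then obtain x y where "x \<in> c" "y \<in> d" "z = x \<otimes>\<^bsub>free_chains X k\<^esub> y"
    by (auto simp: chains_def set_mult_def)
  then show "z \<in> carrier (free_chains X k)"
    using assms by (blast intro: free_chains_mult_closed)
qed

text \<open>Direct images commute with the union over representatives in \<open>boundary\<close>, so
  \<open>c\<close> may be any set.\<close>

lemma image_boundary: "frag_map f ` boundary X k c = boundary Y k (frag_map f ` c)"
  by (simp add: boundary_def image_UN r_coset_eq_set_mult image_set_mult[of "frag_map f", OF frag_map_mult]
    frag_map_orientation_rels frag_map_free_boundary)

text \<open>Deleting one of \<open>k + 2\<close> vertices leaves a nonempty face, which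
  \<open>down\<close> accepts as a simplex.\<close>

lemma free_boundary_closed:
  assumes "x \<in> carrier (free_chains X (Suc k))"
  shows "free_boundary x \<in> carrier (free_chains X k)"
proof -
  have "take i vs @ drop (Suc i) vs \<in> ordered_simplices X k"
    if "vs \<in> ordered_simplices X (Suc k)" "i < length vs" for vs i
  proof -
    have d: "distinct (take i vs @ drop (Suc i) vs)"
      using that by (auto simp: ordered_simplices_def set_take_disj_set_drop_if_distinct)
    have s: "set (take i vs @ drop (Suc i) vs) \<subseteq> set vs"
      by (auto dest: in_set_takeD in_set_dropD)
    have l: "length (take i vs @ drop (Suc i) vs) = Suc k"
      using that by (auto simp: ordered_simplices_def)
    then have "set (take i vs @ drop (Suc i) vs) \<noteq> {}" by fastforce
    with d s l show ?thesis using that(1) down unfolding ordered_simplices_def by blast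
  qed
  then have "Poly_Mapping.keys (\<Sum>i<length vs. frag_cmul ((- 1) ^ i) (frag_of (take i vs @ drop (Suc i) vs)))
      \<subseteq> ordered_simplices X k" if "vs \<in> ordered_simplices X (Suc k)" for vs
    using that by (intro order_trans[OF keys_sum]) (auto dest!: subsetD[OF keys_cmul])
  then show ?thesis
    using assms unfolding free_boundary_def free_chains_def
    by (auto dest!: subsetD[OF keys_frag_extend])
qed

lemma boundary_closed:
  assumes "c \<subseteq> carrier (free_chains X (Suc k))"
  shows "boundary X k c \<subseteq> carrier (free_chains X k)"
proof
  fix y assume "y \<in> boundary X k c"
  then obtain x r where "x \<in> c" "r \<in> orientation_rels X k" "y = r \<otimes>\<^bsub>free_chains X k\<^esub> free_boundary x"
    by (auto simp: boundary_def r_coset_def)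
  then show "y \<in> carrier (free_chains X k)"
    using assms orientation_rels_subset[of k]
    by (blast intro: free_chains_mult_closed free_boundary_closed)
qed

text \<open>Above degree 0, being a cycle is an equation between two sets of chains: the boundary
  equals \<open>orientation_rels\<close>, the unit of \<open>chains\<close>. Direct images preserve
  it, and injectivity on the carrier containing both sets reflects it.\<close>

lemma image_cycles: "image (frag_map f) ` cycles X k = cycles Y k"
proof (cases k)
  case 0
  then show ?thesis by (simp add: image_chains_carrier)
next
  case (Suc j)
  have "boundary Y j (frag_map f ` c) = orientation_rels Y j \<longleftrightarrow> boundary X j c = orientation_rels X j"
    if "c \<in> carrier (chains X (Suc j))" for c
  proof -
    have "boundary X j c \<subseteq> carrier (free_chains X j)"
      using subsetD[OF chains_subset that] by (intro boundary_closed) (rule PowD)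
    then show ?thesis
      using inj_on_image_eq_iff[OF inj_frag_map, of "boundary X j c" j "orientation_rels X j"]
        orientation_rels_subset[of j]
      by (auto simp: image_boundary frag_map_orientation_rels)
  qed
  then show ?thesis using Suc
    by (auto simp: kernel_def one_chains simp flip: image_chains_carrier)
qed

lemma image_boundaries: "image (frag_map f) ` boundaries X k = boundaries Y k"
  by (simp add: boundaries_def image_boundary image_image flip: image_chains_carrier)

theorem homology_iso: "homology X k \<cong> homology Y k"
proof -
  have "cycles X k \<subseteq> carrier (chains X k)"
    by (cases k) (auto simp: kernel_def)
  then have cyc: "cycles X k \<subseteq> Pow (carrier (free_chains X k))"
    using chains_subset by blast
  have bd: "boundaries X k \<subseteq> Pow (carrier (free_chains X k))"
    using boundary_closed[OF PowD[OF subsetD[OF chains_subset]]]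
    by (simp add: boundaries_def image_subset_iff)
  have "image (image (frag_map f)) \<in> iso (homology X k) (homology Y k)"
    unfolding homology_def image_boundaries[symmetric]
  \<comment> \<open>Here \<open>h\<close> is \<open>image (frag_map f)\<close>, acting on cosets,
    and \<open>C\<close> consists of all sets of chains, so it contains the cycles and the
    boundaries and is closed under the coset product.\<close>
  proof (rule Mod_iso_image[where C = "Pow (carrier (free_chains X k))"], goal_cases)
    case (1 x y)
    show ?case by (simp add: image_chains_mult)
  next
    case 2
    show ?case by (simp add: image_cycles)
  next
    case (3 x y)
    then show ?case using chains_mult_closed by simp
  next
    case 4
    show ?case using cyc by simp
  next
    case 5
    show ?case by (rule bd)
  next
    case 6
    show ?case by (rule inj_on_image_Pow[OF inj_frag_map])
  qed
  then show ?thesis by (auto simp: is_iso_def)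
qed

end

theorem corollary1:
  fixes V :: "'a \<Rightarrow> 'p set" and A B :: "'a formula"
  assumes "\<And>\<alpha>. countable (V \<alpha>)"
    and "isomorphic_types A B"
  shows "\<forall>k. homology (union_complex (formula_complex V A)) k \<cong> homology (union_complex (formula_complex V B)) k"
proof -
  let ?X = "formula_complex V A" and ?Y = "formula_complex V B"
  obtain f where inj: "inj_on f (pts V A)" and f: "simplices ?Y = image f ` simplices ?X"
    using simplices_formula_complex_image[OF assms(2)] by blast
  have sub: "simplices ?X \<subseteq> Pow (pts V A)"
    unfolding formula_complex_def by (auto dest: sem_typed)
  interpret complex_iso "union_complex ?X" "union_complex ?Y" "image f"
  proof
    fix x y assume "x \<in> simplices (union_complex ?X)" "y \<subseteq> x" "y \<noteq> {}"
    then show "y \<in> simplices (union_complex ?X)"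
      using asc_union_formula_complex[of V A, OF assms(1)] unfolding asc_def by blast
  next
    \<comment> \<open>The vertices are themselves sets of points within \<open>pts V A\<close>, so
      injectivity of \<open>f\<close> there passes to \<open>image f\<close>.\<close>
    have "\<Union>(simplices (union_complex ?X)) \<subseteq> simplices ?X"
      by (auto simp: union_complex_def)
    then show "inj_on (image f) (\<Union>(simplices (union_complex ?X)))"
      using inj_on_image_Pow[OF inj] sub by (meson inj_on_subset order_trans)
  next
    show "simplices (union_complex ?Y) = image (image f) ` simplices (union_complex ?X)"
      by (rule simplices_union_complex_image[OF inj sub f])
  qed
  show ?thesis by (simp add: homology_iso)
qed

end
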